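(* Let $1\le r\le s$, let $A\in\mathbb{C}_r^{m\times n}$ and $\widetilde A=A+E\in\mathbb{C}_s^{m\times n}$ have generalized polar decompositions $A=QH$ and $\widetilde A=\widetilde Q\widetilde H$, and let $\sigma_1\ge\dots\ge\sigma_r>0$ and $\widetilde\sigma_1\ge\dots\ge\widetilde\sigma_s>0$ be the nonzero singular values of $A$ and $\widetilde A$. Then $$\|Q-\widetilde Q\|_F\ge \sqrt{\min_{0\le k\le r}\frac{s-r+4k}{\sum_{j=1}^{k}(\sigma_j+\widetilde\sigma_j)^2+\sum_{j=1}^{r-k}(\sigma_{r+1-j}-\widetilde\sigma_{s-r+k+j})^2+\sum_{j=k+1}^{s-r+k}\widetilde\sigma_j^2}}\;\|E\|_F .$$ Moreover the coefficient of $\|E\|_F$ is optimal: for given $m,n$ and given $\sigma_1\ge\dots\ge\sigma_r>0$, $\widetilde\sigma_1\ge\dots\ge\widetilde\sigma_s>0$ with $s\le\min(m,n)$, it cannot be replaced by any larger number so that the inequality still holds for all $A\in\mathbb{C}_r^{m\times n}$, $\widetilde A\in\mathbb{C}_s^{m\times n}$ with these nonzero singular values.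
   Context: $\mathbb{C}^{m\times n}_r$ denotes the set of complex $m\times n$ matrices of rank $r$; $\|\cdot\|_F$ is the Frobenius norm. For $A\in\mathbb{C}_r^{m\times n}$, the generalized polar decomposition is $A=QH$ with $Q\in\mathbb{C}_r^{m\times n}$ subunitary (a partial isometry) and $H\in\mathbb{C}_r^{n\times n}$ positive semidefinite, subject to $\mathcal R(Q^* )=\mathcal R(H)$ (column spaces), which makes it unique; in fact $H=|A|:=(A^*A)^{1/2}$. $Q$ is the subunitary polar factor and $H$ the positive polar factor. Empty sums are $0$. A term of the form $0/0$ (which can occur only for $k=0$, $r=s$ and all $\sigma_j$, $\widetilde\sigma_j$ equal to one common value) is omitted from the minimum. *)

theory Defs
  imports
    "HOL-Computational_Algebra.Polynomial"
    "Jordan_Normal_Form.Char_Poly"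
    "Jordan_Normal_Form.Matrix_Kernel"
    "Jordan_Normal_Form.Schur_Decomposition"
    "Jordan_Normal_Form.DL_Rank"
begin

definition cmats_of_rank :: "nat \<Rightarrow> nat \<Rightarrow> nat \<Rightarrow> complex mat set" where
  "cmats_of_rank m n r = {A \<in> carrier_mat m n. vec_space.rank m A = r}"

definition frobenius_norm :: "complex mat \<Rightarrow> real" where
  "frobenius_norm A = sqrt (\<Sum>i<dim_row A. \<Sum>j<dim_col A. (cmod (A $$ (i, j)))\<^sup>2)"

text \<open>A partial isometry preserves lengths on the orthogonal complement of its kernel. Equality
  of the squared lengths \<open>x \<bullet>c x\<close> stands for equality of the Euclidean norms.\<close>

definition subunitary :: "complex mat \<Rightarrow> bool" where
  "subunitary Q \<longleftrightarrow>
     (\<forall>x \<in> carrier_vec (dim_col Q). (\<forall>y \<in> mat_kernel Q. x \<bullet>c y = 0) \<longrightarrow>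
        (Q *\<^sub>v x) \<bullet>c (Q *\<^sub>v x) = x \<bullet>c x)"

text \<open>The order on \<^typ>\<open>complex\<close> is the partial one: \<open>0 \<le> z\<close> says that \<open>z\<close> is real and nonnegative.\<close>

definition pos_semidef :: "complex mat \<Rightarrow> bool" where
  "pos_semidef H \<longleftrightarrow> square_mat H \<and> mat_adjoint H = H \<and>
     (\<forall>x \<in> carrier_vec (dim_row H). 0 \<le> (H *\<^sub>v x) \<bullet>c x)"

definition generalized_polar :: "complex mat \<Rightarrow> complex mat \<Rightarrow> complex mat \<Rightarrow> bool" where
  "generalized_polar A Q H \<longleftrightarrow>
     (let m = dim_row A; n = dim_col A; r = vec_space.rank m A in
        Q \<in> cmats_of_rank m n r \<and> subunitary Q \<and>
        H \<in> cmats_of_rank n n r \<and> pos_semidef H \<and>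
        A = Q * H \<and>
        vec_space.col_space n (mat_adjoint Q) = vec_space.col_space n H)"

text \<open>The square roots of the \<open>n\<close> eigenvalues of \<open>A\<^sup>*A\<close> (real and nonnegative), counted with
  multiplicity, for \<open>A\<close> with \<open>n\<close> columns. If \<open>n\<close> exceeds the number of rows, only the multiplicity
  of \<open>0\<close> differs from the convention with \<open>min(m,n)\<close> singular values.\<close>

definition singular_values :: "complex mat \<Rightarrow> real multiset" where
  "singular_values A = image_mset (\<lambda>z. sqrt (Re z)) (proots (char_poly (mat_adjoint A * A)))"

definition nonzero_singular_values :: "complex mat \<Rightarrow> real multiset" where
  "nonzero_singular_values A = filter_mset (\<lambda>x. x \<noteq> 0) (singular_values A)"

definition polar_num :: "nat \<Rightarrow> nat \<Rightarrow> nat \<Rightarrow> real" where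
  "polar_num r s k = real s - real r + 4 * real k"

text \<open>The sequences \<open>\<sigma>\<close> and \<open>\<sigma>'\<close> are indexed from 1.\<close>

definition polar_den :: "nat \<Rightarrow> nat \<Rightarrow> (nat \<Rightarrow> real) \<Rightarrow> (nat \<Rightarrow> real) \<Rightarrow> nat \<Rightarrow> real" where
  "polar_den r s \<sigma> \<sigma>' k =
     (\<Sum>j = 1..k. (\<sigma> j + \<sigma>' j)\<^sup>2)
   + (\<Sum>j = 1..r - k. (\<sigma> (r + 1 - j) - \<sigma>' (s - r + k + j))\<^sup>2)
   + (\<Sum>j = k + 1..s - r + k. (\<sigma>' j)\<^sup>2)"

text \<open>Terms of the form \<open>0/0\<close> are left out of the minimum; with HOL's \<open>x / 0 = 0\<close> they would
  otherwise contribute the value \<open>0\<close>.\<close>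

definition polar_coeff :: "nat \<Rightarrow> nat \<Rightarrow> (nat \<Rightarrow> real) \<Rightarrow> (nat \<Rightarrow> real) \<Rightarrow> real" where
  "polar_coeff r s \<sigma> \<sigma>' =
     sqrt (Min ((\<lambda>k. polar_num r s k / polar_den r s \<sigma> \<sigma>' k) `
       {k \<in> {0..r}. \<not> (polar_num r s k = 0 \<and> polar_den r s \<sigma> \<sigma>' k = 0)}))"

end

theory Submission
  imports Defs
begin

text \<open>
  Let \<open>B = A + E\<close>, and write \<open>A\<close> as the sum of the \<open>\<sigma>\<^sub>i u\<^sub>i v\<^sub>i\<^sup>*\<close> and \<open>B\<close> as the sum of the
  \<open>\<sigma>'\<^sub>j u'\<^sub>j v'\<^sub>j\<^sup>*\<close> with orthonormal families of vectors. The polar factors \<open>Q\<close> and \<open>Q'\<close> are the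
  same sums with all weights replaced by \<open>1\<close> (\<open>generalized_polar_singular_expansion\<close>). Put
  \<open>M\<^sub>i\<^sub>j = Re (\<langle>u\<^sub>i, u'\<^sub>j\<rangle> cnj \<langle>v\<^sub>i, v'\<^sub>j\<rangle>)\<close>. Both squared distances are affine functions of the
  \<open>r \<times> s\<close> matrix \<open>M\<close>:

  \<open>\<parallel>Q - Q'\<parallel>\<^sup>2 = r + s - 2 \<Sum> M\<^sub>i\<^sub>j\<close> and
  \<open>\<parallel>A - B\<parallel>\<^sup>2 = \<Sum> \<sigma>\<^sub>i\<^sup>2 + \<Sum> \<sigma>'\<^sub>j\<^sup>2 - 2 \<Sum> \<sigma>\<^sub>i \<sigma>'\<^sub>j M\<^sub>i\<^sub>j\<close>.

  By Bessel's inequality \<open>\<bar>M\<bar>\<close> lies below a doubly substochastic matrix. If \<open>\<rho>\<close> is the square of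
  the coefficient, it remains to show \<open>\<rho> \<parallel>A - B\<parallel>\<^sup>2 \<le> \<parallel>Q - Q'\<parallel>\<^sup>2\<close>, which is now a linear inequality
  on a polytope of matrices \<open>M\<close>. Its relevant vertices are signed partial permutation matrices
  with \<open>r\<close> nonzero entries. With \<open>k\<close> negative entries the squared distance of the polar factors is
  \<open>s - r + 4 k\<close>, and the denominator in the coefficient is the largest possible value of
  \<open>\<parallel>A - B\<parallel>\<^sup>2\<close>.

  The proof avoids a theorem on vertices. It writes \<open>M = P - N\<close>, where \<open>P\<close> and \<open>N\<close> are nonnegative
  and the rows of \<open>P + N\<close> have sum \<open>1\<close>, and fixes the total mass \<open>\<kappa>\<close> of \<open>N\<close>. Since the singular
  values decrease, summation by parts in both indices (\<open>double_Abel_summation\<close>) reduces an upper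
  bound for \<open>\<Sum> \<sigma>\<^sub>i \<sigma>'\<^sub>j (N\<^sub>i\<^sub>j - P\<^sub>i\<^sub>j)\<close> to upper bounds for the sums of \<open>N - P\<close> over top left corners.
  The latter are bounded by counting mass (\<open>corner_le_extremal_corner\<close>). The bounds are affine in
  \<open>\<kappa>\<close> between integers (\<open>extremal_corner_interpolation\<close>), and at an integer \<open>k\<close> they are all
  attained by one signed partial permutation matrix (\<open>sum_extremal_corner\<close>), which yields exactly the
  denominator. So the inequality for all \<open>\<kappa>\<close> follows from the inequality for \<open>k = 0, \<dots>, r\<close>,
  and this is how \<open>\<rho>\<close> is defined.

  The bound is optimal because the extremal signed partial permutation for a minimizing \<open>k\<close> is realized by
  two diagonal matrices (\<open>polar_bound_attained\<close>).
\<close>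

section \<open>Corner sums and the extremal pairing\<close>

text \<open>The last decrement is \<open>f r\<close> itself, as if \<open>f\<close> were continued by \<open>0\<close> beyond \<open>r\<close>; thus the
decrements from \<open>i\<close> on add up to \<open>f i\<close>.\<close>

definition decrement :: "nat \<Rightarrow> (nat \<Rightarrow> real) \<Rightarrow> nat \<Rightarrow> real" where
  "decrement r f a = f a - (if a < r then f (Suc a) else 0)"

lemma sum_decrement:
  assumes "i \<le> r"
  shows "(\<Sum>a = i..r. decrement r f a) = f i"
proof -
  have "(\<Sum>a = r - d..r. decrement r f a) = f (r - d)" if "d \<le> r" for d
    using that
  proof (induction d)
    case 0
    then show ?case by (simp add: decrement_def)
  next
    case (Suc d)
    have "{r - Suc d..r} = insert (r - Suc d) {r - d..r}" using Suc.prems by auto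
    moreover have "Suc (r - Suc d) = r - d" using Suc.prems by simp
    ultimately show ?case using Suc by (simp add: decrement_def)
  qed
  from this[of "r - i"] show ?thesis using assms by simp
qed

lemma decrement_nonneg:
  assumes "antimono_on {1..r} f" "\<forall>i \<in> {1..r}. 0 < f i" "a \<in> {1..r}"
  shows "0 \<le> decrement r f a"
proof (cases "a < r")
  case True
  then have "f (Suc a) \<le> f a"
    using assms(3) by (intro monotone_onD[OF assms(1)]) auto
  then show ?thesis using True by (simp add: decrement_def)
next
  case False
  then show ?thesis using assms(2,3) by (simp add: decrement_def less_imp_le)
qed

text \<open>Summation by parts in both indices. For decreasing positive \<open>f\<close> and \<open>g\<close> the decrements are
nonnegative, so upper bounds for the corner sums of \<open>X\<close> bound the bilinear sum on the left.\<close>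

lemma double_Abel_summation:
  "(\<Sum>i = 1..r. \<Sum>j = 1..s. f i * g j * X i j) =
   (\<Sum>a = 1..r. \<Sum>b = 1..s. decrement r f a * decrement s g b * (\<Sum>i = 1..a. \<Sum>j = 1..b. X i j))"
proof -
  have single: "(\<Sum>i = 1..t. h i * Y i) = (\<Sum>a = 1..t. decrement t h a * (\<Sum>i = 1..a. Y i))"
    for t h and Y :: "nat \<Rightarrow> real"
  proof -
    have "(\<Sum>i = 1..t. h i * Y i) = (\<Sum>i = 1..t. \<Sum>a = i..t. decrement t h a * Y i)"
      by (intro sum.cong refl) (simp add: sum_decrement flip: sum_distrib_right)
    also have "\<dots> = (\<Sum>a = 1..t. \<Sum>i = 1..a. decrement t h a * Y i)"
      by (subst sum.Sigma, simp, simp, subst sum.Sigma, simp, simp,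
          rule sum.reindex_bij_witness[of _ "\<lambda>(a, i). (i, a)" "\<lambda>(i, a). (a, i)"]) auto
    finally show ?thesis by (simp add: sum_distrib_left)
  qed
  have inner: "(\<Sum>j = 1..s. g j * (\<Sum>i = 1..a. X i j)) =
      (\<Sum>b = 1..s. decrement s g b * (\<Sum>i = 1..a. \<Sum>j = 1..b. X i j))" for a
    by (subst single, rule sum.cong[OF refl], subst sum.swap) (rule refl)
  have "(\<Sum>i = 1..r. \<Sum>j = 1..s. f i * g j * X i j) =
        (\<Sum>i = 1..r. f i * (\<Sum>j = 1..s. g j * X i j))"
    by (simp add: sum_distrib_left mult.assoc)
  also have "\<dots> = (\<Sum>a = 1..r. decrement r f a * (\<Sum>i = 1..a. \<Sum>j = 1..s. g j * X i j))"
    by (rule single)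
  also have "\<dots> = (\<Sum>a = 1..r. decrement r f a * (\<Sum>j = 1..s. g j * (\<Sum>i = 1..a. X i j)))"
    by (simp only: sum_distrib_left, rule sum.cong[OF refl], rule sum.swap)
  also have "\<dots> = (\<Sum>a = 1..r. decrement r f a *
      (\<Sum>b = 1..s. decrement s g b * (\<Sum>i = 1..a. \<Sum>j = 1..b. X i j)))"
    by (simp only: inner)
  finally show ?thesis by (simp add: sum_distrib_left mult.assoc)
qed

text \<open>For an integer \<open>\<kappa> = k \<le> r\<close> this is the sum over the top left \<open>a \<times> b\<close> corner of the signed
partial permutation matrix of size \<open>r \<times> s\<close> with entries \<open>1\<close> at \<open>(i, i)\<close> for \<open>i \<le> k\<close> and entries
\<open>-1\<close> at \<open>(i, s + 1 + k - i)\<close> for \<open>i > k\<close>. Among all such matrices with \<open>k\<close> entries \<open>1\<close> and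
\<open>r - k\<close> entries \<open>-1\<close> it has the largest corner sums. The formula makes sense for real \<open>\<kappa>\<close>,
which then stands for a total mass.\<close>

definition extremal_corner :: "nat \<Rightarrow> nat \<Rightarrow> nat \<Rightarrow> real \<Rightarrow> real" where
  "extremal_corner s a b \<kappa> =
     min \<kappa> (min (real a) (real b)) - max 0 (real a + real b - real s - \<kappa>)"

lemma sum_block_mono:
  fixes X :: "nat \<Rightarrow> nat \<Rightarrow> real"
  assumes "\<And>i j. i \<in> I \<Longrightarrow> j \<in> J \<Longrightarrow> 0 \<le> X i j" "I' \<subseteq> I" "J' \<subseteq> J" "finite I" "finite J"
  shows "(\<Sum>i\<in>I'. \<Sum>j\<in>J'. X i j) \<le> (\<Sum>i\<in>I. \<Sum>j\<in>J. X i j)"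
proof -
  have "(\<Sum>i\<in>I'. \<Sum>j\<in>J'. X i j) \<le> (\<Sum>i\<in>I'. \<Sum>j\<in>J. X i j)"
    using assms by (intro sum_mono sum_mono2) auto
  also have "\<dots> \<le> (\<Sum>i\<in>I. \<Sum>j\<in>J. X i j)"
    using assms by (intro sum_mono2 sum_nonneg) auto
  finally show ?thesis .
qed

text \<open>The corner of \<open>N\<close> has mass at most \<open>\<kappa>\<close>, \<open>a\<close> and \<open>b\<close>. The corner of \<open>P + N\<close> has mass at least
\<open>a - (s - b)\<close>, because its \<open>a\<close> full rows have mass \<open>a\<close> and the \<open>s - b\<close> columns outside the
corner hold at most \<open>s - b\<close> of it; so whatever \<open>N\<close> does not supply, \<open>P\<close> must.\<close>

lemma corner_le_extremal_corner:
  fixes P N :: "nat \<Rightarrow> nat \<Rightarrow> real"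
  assumes nonneg: "\<And>i j. i \<in> {1..r} \<Longrightarrow> j \<in> {1..s} \<Longrightarrow> 0 \<le> P i j \<and> 0 \<le> N i j"
    and rows: "\<And>i. i \<in> {1..r} \<Longrightarrow> (\<Sum>j = 1..s. P i j + N i j) = 1"
    and cols: "\<And>j. j \<in> {1..s} \<Longrightarrow> (\<Sum>i = 1..r. P i j + N i j) \<le> 1"
    and ab: "a \<le> r" "b \<le> s"
  shows "(\<Sum>i = 1..a. \<Sum>j = 1..b. N i j - P i j)
         \<le> extremal_corner s a b (\<Sum>i = 1..r. \<Sum>j = 1..s. N i j)"
proof -
  let ?S = "\<lambda>i j. P i j + N i j"
  define p n where "p = (\<Sum>i = 1..a. \<Sum>j = 1..b. P i j)" and "n = (\<Sum>i = 1..a. \<Sum>j = 1..b. N i j)"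
  have S: "0 \<le> ?S i j" if "i \<in> {1..r}" "j \<in> {1..s}" for i j using nonneg[OF that] by simp
  have p0: "0 \<le> p" unfolding p_def using nonneg ab by (intro sum_nonneg) auto
  have n\<kappa>: "n \<le> (\<Sum>i = 1..r. \<Sum>j = 1..s. N i j)"
    unfolding n_def using nonneg ab by (intro sum_block_mono) auto
  have pn: "p + n = (\<Sum>i = 1..a. \<Sum>j = 1..b. ?S i j)"
    by (simp add: p_def n_def sum.distrib)
  have "(\<Sum>i = 1..a. \<Sum>j = 1..b. ?S i j) \<le> (\<Sum>i = 1..a. \<Sum>j = 1..s. ?S i j)"
    using S ab by (intro sum_block_mono) auto
  also have "\<dots> = (\<Sum>i = 1..a. 1)" using rows ab by (intro sum.cong) auto
  finally have na: "n \<le> real a" using p0 pn by simp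
  have "(\<Sum>i = 1..a. \<Sum>j = 1..b. ?S i j) \<le> (\<Sum>i = 1..r. \<Sum>j = 1..b. ?S i j)"
    using S ab by (intro sum_block_mono) auto
  also have "\<dots> = (\<Sum>j = 1..b. \<Sum>i = 1..r. ?S i j)" by (rule sum.swap)
  also have "\<dots> \<le> (\<Sum>j = 1..b. 1)" using cols ab by (intro sum_mono) auto
  finally have nb: "n \<le> real b" using p0 pn by simp
  \<comment> \<open>The mass of the first \<open>a\<close> rows, split at column \<open>b\<close>.\<close>
  have "real a = (\<Sum>i = 1..a. \<Sum>j = 1..s. ?S i j)"
    using rows ab by simp
  also have "\<dots> = (\<Sum>i = 1..a. (\<Sum>j = 1..b. ?S i j) + (\<Sum>j = Suc b..s. ?S i j))"
    using ab sum.ub_add_nat[of 1 b "\<lambda>j. ?S _ j" "s - b"] by (intro sum.cong refl) simp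
  also have "\<dots> = (p + n) + (\<Sum>i = 1..a. \<Sum>j = Suc b..s. ?S i j)"
    unfolding pn by (rule sum.distrib)
  also have "(\<Sum>i = 1..a. \<Sum>j = Suc b..s. ?S i j) \<le> (\<Sum>i = 1..r. \<Sum>j = Suc b..s. ?S i j)"
    using S ab by (intro sum_block_mono) auto
  also have "\<dots> = (\<Sum>j = Suc b..s. \<Sum>i = 1..r. ?S i j)" by (rule sum.swap)
  also have "\<dots> \<le> (\<Sum>j = Suc b..s. 1)" using cols ab by (intro sum_mono) auto
  finally have "real a + real b - real s \<le> p + n" using ab by (simp add: of_nat_diff)
  moreover have "(\<Sum>i = 1..a. \<Sum>j = 1..b. N i j - P i j) = n - p"
    by (simp add: p_def n_def sum_subtractf)
  ultimately show ?thesis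
    using p0 n\<kappa> na nb unfolding extremal_corner_def by linarith
qed

text \<open>All breakpoints of the corner bound as a function of \<open>\<kappa>\<close> are integers, so it is affine between
consecutive integers. This is what replaces an argument with the vertices of the polytope of
doubly substochastic matrices.\<close>

lemma extremal_corner_interpolation:
  assumes "real k \<le> \<kappa>" "\<kappa> \<le> real k + 1"
  shows "extremal_corner s a b \<kappa> = (real k + 1 - \<kappa>) * extremal_corner s a b (real k)
           + (\<kappa> - real k) * extremal_corner s a b (real (Suc k))"
proof -
  define \<theta> where "\<theta> = \<kappa> - real k"
  have \<theta>: "0 \<le> \<theta>" "\<theta> \<le> 1" "\<kappa> = real k + \<theta>" using assms by (auto simp: \<theta>_def)
  \<comment> \<open>\<open>min x c\<close> is affine on \<open>[k, k + 1]\<close> because \<open>c\<close> does not lie strictly inside.\<close>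
  have mn: "min (real k + \<theta>) (of_int c) = (1 - \<theta>) * min (real k) (of_int c) + \<theta> * min (real k + 1) (of_int c)"
    for c :: int
  proof (cases "c \<le> int k")
    case True
    then have "real_of_int c \<le> real k" by linarith
    then show ?thesis using \<theta> by (simp add: min_def algebra_simps)
  next
    case False
    then have "real k + 1 \<le> real_of_int c" by linarith
    then show ?thesis using \<theta> by (simp add: min_def algebra_simps)
  qed
  have mx: "max 0 (real a + real b - real s - x) = (real a + real b - real s) - min x (of_int (int a + int b - int s))"
    for x by (simp add: max_def min_def)
  have "min x (min (real a) (real b)) = min x (of_int (min (int a) (int b)))" for x
    by (simp add: of_int_min)
  note e = extremal_corner_def this mx
  show ?thesis
    unfolding e \<theta>(3) by (simp only: mn of_nat_Suc) (simp add: algebra_simps)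
qed

text \<open>For an integer \<open>k\<close> the bounds for the different corners are attained together, by the matrix with
entries \<open>1\<close> at \<open>(i, i)\<close> for \<open>i \<le> k\<close> and \<open>-1\<close> at \<open>(i, s + 1 + k - i)\<close> for \<open>i > k\<close>.\<close>

lemma sum_extremal_corner:
  assumes "k \<le> r" "r \<le> s"
  shows "(\<Sum>a = 1..r. \<Sum>b = 1..s. decrement r f a * decrement s g b * extremal_corner s a b (real k))
    = (\<Sum>j = 1..k. f j * g j) - (\<Sum>i = Suc k..r. f i * g (s + 1 + k - i))"
proof -
  define X :: "nat \<Rightarrow> nat \<Rightarrow> real" where
    "X i j = (if i \<le> k then of_bool (j = i) else - of_bool (j = s + 1 + k - i))" for i j
  have row: "(\<Sum>j = 1..b. h j * X i j) = (if i \<le> k then of_bool (i \<le> b) * h i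
      else - of_bool (s + 1 + k \<le> b + i) * h (s + 1 + k - i))" if "1 \<le> i" "i \<le> r" for i b h
  proof -
    have "(\<Sum>j = 1..b. h j * X i j) = (\<Sum>j = 1..b. if j = (if i \<le> k then i else s + 1 + k - i)
        then (if i \<le> k then 1 else -1) * h j else 0)"
      by (intro sum.cong) (auto simp: X_def)
    also have "\<dots> = (if i \<le> k then of_bool (i \<le> b) * h i
      else - of_bool (s + 1 + k \<le> b + i) * h (s + 1 + k - i))"
      using that assms by (subst sum.delta) auto
    finally show ?thesis .
  qed
  have corner: "(\<Sum>i = 1..a. \<Sum>j = 1..b. X i j) = extremal_corner s a b (real k)"
    if ab: "a \<le> r" "b \<le> s" for a b
  proof -
    have "(\<Sum>i = 1..a. \<Sum>j = 1..b. X i j) = 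
        (\<Sum>i = 1..a. of_bool (i \<le> k \<and> i \<le> b) - of_bool (k < i \<and> s + 1 + k \<le> b + i))"
      using ab row[of _ "\<lambda>_. 1" b] by (intro sum.cong) auto
    also have "\<dots> = real (card ({1..a} \<inter> {i. i \<le> k \<and> i \<le> b}))
        - real (card ({1..a} \<inter> {i. k < i \<and> s + 1 + k \<le> b + i}))"
      by (simp add: sum_subtractf sum_of_bool_eq)
    also have "{1..a} \<inter> {i. i \<le> k \<and> i \<le> b} = {1..min k (min a b)}" by auto
    also have "{1..a} \<inter> {i. k < i \<and> s + 1 + k \<le> b + i} = {s + 1 + k - b..a}"
      using ab by auto
    also have "real (card {1..min k (min a b)}) = min (real k) (min (real a) (real b))" by simp
    also have "real (card {s + 1 + k - b..a}) = max 0 (real a + real b - real s - real k)"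
      using ab by (auto simp: max_def of_nat_diff)
    finally show ?thesis by (simp add: extremal_corner_def)
  qed
  have split: "sum h {1..r} = sum h {1..k} + sum h {Suc k..r}" for h :: "nat \<Rightarrow> real"
    using assms sum.ub_add_nat[of 1 k h "r - k"] by simp
  have "(\<Sum>a = 1..r. \<Sum>b = 1..s. decrement r f a * decrement s g b * extremal_corner s a b (real k))
    = (\<Sum>i = 1..r. \<Sum>j = 1..s. f i * g j * X i j)"
    by (subst double_Abel_summation[where f = f and g = g and X = X], intro sum.cong refl) (simp add: corner del: One_nat_def)
  also have "\<dots> = (\<Sum>i = 1..r. f i * (\<Sum>j = 1..s. g j * X i j))"
    by (simp add: sum_distrib_left mult.assoc)
  also have "\<dots> = (\<Sum>i = 1..r. f i * (if i \<le> k then g i else - g (s + 1 + k - i)))"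
    using assms by (intro sum.cong refl) (subst row, auto)
  also have "\<dots> = (\<Sum>i = 1..k. f i * (if i \<le> k then g i else - g (s + 1 + k - i)))
      + (\<Sum>i = Suc k..r. f i * (if i \<le> k then g i else - g (s + 1 + k - i)))"
    by (rule split)
  also have "\<dots> = (\<Sum>j = 1..k. f j * g j) - (\<Sum>i = Suc k..r. f i * g (s + 1 + k - i))"
    by (simp add: sum_negf)
  finally show ?thesis .
qed

lemma polar_den_reindexed:
  assumes "k \<le> r" "r \<le> s"
  shows "polar_den r s \<sigma> \<sigma>' k = (\<Sum>j = 1..k. (\<sigma> j + \<sigma>' j)\<^sup>2)
    + (\<Sum>i = Suc k..r. (\<sigma> i - \<sigma>' (s + 1 + k - i))\<^sup>2) + (\<Sum>j = Suc k..s - r + k. (\<sigma>' j)\<^sup>2)"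
proof -
  have "(\<Sum>j = 1..r - k. (\<sigma> (r + 1 - j) - \<sigma>' (s - r + k + j))\<^sup>2)
      = (\<Sum>i = Suc k..r. (\<sigma> i - \<sigma>' (s + 1 + k - i))\<^sup>2)"
  proof (intro sum.reindex_bij_witness[of _ "\<lambda>i. r + 1 - i" "\<lambda>i. r + 1 - i"])
    fix j assume "j \<in> {1..r - k}"
    then have "s + 1 + k - (r + 1 - j) = s - r + k + j" using assms by auto
    then show "(\<sigma> (r + 1 - j) - \<sigma>' (s + 1 + k - (r + 1 - j)))\<^sup>2
        = (\<sigma> (r + 1 - j) - \<sigma>' (s - r + k + j))\<^sup>2" by simp
  qed (use assms in auto)
  then show ?thesis by (simp add: polar_den_def)
qed

text \<open>Expanding the squares isolates the constant part, which does not depend on \<open>k\<close>, from the mixed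
products. The latter are exactly the extremal value of the bilinear form.\<close>

lemma polar_den_eq_extremal_corners:
  assumes "k \<le> r" "r \<le> s"
  shows "polar_den r s \<sigma> \<sigma>' k = (\<Sum>i = 1..r. (\<sigma> i)\<^sup>2) + (\<Sum>j = 1..s. (\<sigma>' j)\<^sup>2) + 2 *
    (\<Sum>a = 1..r. \<Sum>b = 1..s. decrement r \<sigma> a * decrement s \<sigma>' b * extremal_corner s a b (real k))"
proof -
  have "{1..r} = {1..k} \<union> {Suc k..r}" using assms by auto
  then have r: "(\<Sum>i = 1..r. (\<sigma> i)\<^sup>2) = (\<Sum>i = 1..k. (\<sigma> i)\<^sup>2) + (\<Sum>i = Suc k..r. (\<sigma> i)\<^sup>2)"
    by (simp only:, intro sum.union_disjoint) auto
  have "{1..s} = ({1..k} \<union> {Suc k..s - r + k}) \<union> {s - r + k + 1..s}" using assms by auto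
  then have s: "(\<Sum>i = 1..s. (\<sigma>' i)\<^sup>2) = (\<Sum>i = 1..k. (\<sigma>' i)\<^sup>2) + (\<Sum>i = Suc k..s - r + k. (\<sigma>' i)\<^sup>2)
      + (\<Sum>i = s - r + k + 1..s. (\<sigma>' i)\<^sup>2)"
    by (simp only:, subst sum.union_disjoint, simp, simp, force, subst sum.union_disjoint) auto
  have e: "(\<Sum>i = s - r + k + 1..s. (\<sigma>' i)\<^sup>2) = (\<Sum>i = Suc k..r. (\<sigma>' (s + 1 + k - i))\<^sup>2)"
    using assms by (intro sum.reindex_bij_witness[of _ "\<lambda>i. s + 1 + k - i" "\<lambda>i. s + 1 + k - i"]) auto
  show ?thesis
    unfolding polar_den_reindexed[OF assms] sum_extremal_corner[OF assms] r s e
    by (simp add: power2_sum power2_diff sum.distrib sum_subtractf sum_distrib_left algebra_simps)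
qed

text \<open>With \<open>\<kappa>\<close> the total mass of \<open>N\<close>, the right-hand side is \<open>s - r + 4 \<kappa>\<close>, and the left-hand side is
bounded by a function of \<open>\<kappa>\<close> that is affine between integers. So the inequality only has to hold
at integers \<open>\<kappa> = k\<close>, where it is the hypothesis on \<open>\<rho>\<close>.\<close>

lemma polar_inequality_row_stochastic:
  fixes P N :: "nat \<Rightarrow> nat \<Rightarrow> real"
  assumes rs: "r \<le> s"
    and \<sigma>: "antimono_on {1..r} \<sigma>" "\<forall>i \<in> {1..r}. 0 < \<sigma> i"
    and \<sigma>': "antimono_on {1..s} \<sigma>'" "\<forall>i \<in> {1..s}. 0 < \<sigma>' i"
    and nonneg: "\<And>i j. i \<in> {1..r} \<Longrightarrow> j \<in> {1..s} \<Longrightarrow> 0 \<le> P i j \<and> 0 \<le> N i j"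
    and rows: "\<And>i. i \<in> {1..r} \<Longrightarrow> (\<Sum>j = 1..s. P i j + N i j) = 1"
    and cols: "\<And>j. j \<in> {1..s} \<Longrightarrow> (\<Sum>i = 1..r. P i j + N i j) \<le> 1"
    and \<rho>: "0 \<le> \<rho>" "\<And>k. k \<le> r \<Longrightarrow> \<rho> * polar_den r s \<sigma> \<sigma>' k \<le> polar_num r s k"
  shows "\<rho> * ((\<Sum>i = 1..r. (\<sigma> i)\<^sup>2) + (\<Sum>j = 1..s. (\<sigma>' j)\<^sup>2)
            - 2 * (\<Sum>i = 1..r. \<Sum>j = 1..s. \<sigma> i * \<sigma>' j * (P i j - N i j)))
         \<le> real r + real s - 2 * (\<Sum>i = 1..r. \<Sum>j = 1..s. P i j - N i j)"
proof -
  define \<kappa> where "\<kappa> = (\<Sum>i = 1..r. \<Sum>j = 1..s. N i j)"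
  define C where "C = (\<Sum>i = 1..r. (\<sigma> i)\<^sup>2) + (\<Sum>j = 1..s. (\<sigma>' j)\<^sup>2)"
  define G where "G x = (\<Sum>a = 1..r. \<Sum>b = 1..s.
      decrement r \<sigma> a * decrement s \<sigma>' b * extremal_corner s a b x)" for x
  have tot: "(\<Sum>i = 1..r. \<Sum>j = 1..s. P i j + N i j) = real r" using rows by simp
  have lin: "(\<Sum>i = 1..r. \<Sum>j = 1..s. P i j - N i j) = real r - 2 * \<kappa>"
    unfolding tot[symmetric] \<kappa>_def by (simp add: sum.distrib sum_subtractf)
  have "0 \<le> \<kappa>" unfolding \<kappa>_def using nonneg by (intro sum_nonneg) auto
  have "\<kappa> \<le> real r" unfolding tot[symmetric] \<kappa>_def using nonneg by (intro sum_mono) auto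
  have "- (\<Sum>i = 1..r. \<Sum>j = 1..s. \<sigma> i * \<sigma>' j * (P i j - N i j))
      = (\<Sum>i = 1..r. \<Sum>j = 1..s. \<sigma> i * \<sigma>' j * (N i j - P i j))"
    by (simp add: sum_negf[symmetric] algebra_simps)
  also have "\<dots> \<le> G \<kappa>"
    unfolding G_def \<kappa>_def
    using corner_le_extremal_corner[OF nonneg rows cols] decrement_nonneg[OF \<sigma>] decrement_nonneg[OF \<sigma>']
    by (subst double_Abel_summation) (intro sum_mono mult_left_mono mult_nonneg_nonneg; auto)
  finally have bound: "\<rho> * (C - 2 * (\<Sum>i = 1..r. \<Sum>j = 1..s. \<sigma> i * \<sigma>' j * (P i j - N i j)))
      \<le> \<rho> * (C + 2 * G \<kappa>)"
    using \<rho>(1) by (intro mult_left_mono) auto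
  have G: "\<rho> * (C + 2 * G (real k)) \<le> real s - real r + 4 * real k" if "k \<le> r" for k
    using \<rho>(2)[OF that] unfolding polar_den_eq_extremal_corners[OF that rs] polar_num_def C_def G_def .
  have "\<rho> * (C + 2 * G \<kappa>) \<le> real s - real r + 4 * \<kappa>"
  proof (cases "\<kappa> = real r")
    case True
    then show ?thesis using G[of r] by simp
  next
    case False
    define k where "k = nat \<lfloor>\<kappa>\<rfloor>"
    have k: "real k \<le> \<kappa>" "\<kappa> \<le> real k + 1" "Suc k \<le> r"
      using \<open>0 \<le> \<kappa>\<close> \<open>\<kappa> \<le> real r\<close> False by (auto simp: k_def) linarith+
    have G\<kappa>: "G \<kappa> = (real k + 1 - \<kappa>) * G (real k) + (\<kappa> - real k) * G (real (Suc k))"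
      unfolding G_def extremal_corner_interpolation[OF k(1,2)]
      by (simp only: sum_distrib_left sum.distrib[symmetric]) (simp add: algebra_simps)
    have "\<rho> * (C + 2 * G \<kappa>) = (real k + 1 - \<kappa>) * (\<rho> * (C + 2 * G (real k)))
        + (\<kappa> - real k) * (\<rho> * (C + 2 * G (real (Suc k))))"
      by (subst G\<kappa>) (simp add: algebra_simps)
    also have "\<dots> \<le> (real k + 1 - \<kappa>) * (real s - real r + 4 * real k)
        + (\<kappa> - real k) * (real s - real r + 4 * real (Suc k))"
      using k G[of k] G[of "Suc k"] by (intro add_mono mult_left_mono) auto
    also have "\<dots> = real s - real r + 4 * \<kappa>" by (simp add: algebra_simps)
    finally show ?thesis .
  qed
  from order_trans[OF bound this] show ?thesis unfolding lin C_def by (simp add: algebra_simps)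
qed

text \<open>The row deficits \<open>d\<close> and the column deficits \<open>e\<close> have totals \<open>D\<close> and \<open>E\<close> with \<open>D \<le> E\<close>, since
there are at least as many columns as rows. Adding \<open>d i * e j / E\<close> fills all rows completely
and exceeds no column.\<close>

lemma substochastic_completion:
  fixes T :: "nat \<Rightarrow> nat \<Rightarrow> real"
  assumes "r \<le> s"
    and rows: "\<And>i. i \<in> {1..r} \<Longrightarrow> (\<Sum>j = 1..s. T i j) \<le> 1"
    and cols: "\<And>j. j \<in> {1..s} \<Longrightarrow> (\<Sum>i = 1..r. T i j) \<le> 1"
  obtains S where "\<And>i j. i \<in> {1..r} \<Longrightarrow> j \<in> {1..s} \<Longrightarrow> T i j \<le> S i j"
    and "\<And>i. i \<in> {1..r} \<Longrightarrow> (\<Sum>j = 1..s. S i j) = 1"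
    and "\<And>j. j \<in> {1..s} \<Longrightarrow> (\<Sum>i = 1..r. S i j) \<le> 1"
proof -
  define d where "d i = 1 - (\<Sum>j = 1..s. T i j)" for i
  define e where "e j = 1 - (\<Sum>i = 1..r. T i j)" for j
  define D where "D = (\<Sum>i = 1..r. d i)"
  define E where "E = (\<Sum>j = 1..s. e j)"
  have d: "0 \<le> d i" if "i \<in> {1..r}" for i using rows[OF that] by (simp add: d_def)
  have e: "0 \<le> e j" if "j \<in> {1..s}" for j using cols[OF that] by (simp add: e_def)
  have "E - D = real s - real r"
    unfolding D_def E_def d_def e_def sum_subtractf by (subst (2) sum.swap) simp
  then have DE: "D \<le> E" using assms(1) by simp
  have D0: "0 \<le> D" unfolding D_def using d by (intro sum_nonneg) auto
  define S where "S i j = T i j + d i * e j / E" for i j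
  show thesis
  proof (rule that[of S])
    show "T i j \<le> S i j" if "i \<in> {1..r}" "j \<in> {1..s}" for i j
      using d[OF that(1)] e[OF that(2)] D0 DE by (simp add: S_def)
    show "(\<Sum>j = 1..s. S i j) = 1" if i: "i \<in> {1..r}" for i
    \<comment> \<open>If \<open>E = 0\<close>, then also \<open>D = 0\<close>, and nothing is missing in any row.\<close>
    proof (cases "E = 0")
      case True
      then have "D = 0" using D0 DE by simp
      then have "d i = 0" using d i unfolding D_def by (subst (asm) sum_nonneg_eq_0_iff) auto
      then show ?thesis by (simp add: S_def d_def)
    next
      case False
      have "(\<Sum>j = 1..s. S i j) = (\<Sum>j = 1..s. T i j) + d i * E / E"
        by (simp add: S_def sum.distrib E_def sum_distrib_left sum_divide_distrib)
      then show ?thesis using False by (simp add: d_def)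
    qed
    show "(\<Sum>i = 1..r. S i j) \<le> 1" if j: "j \<in> {1..s}" for j
    proof -
      have "(\<Sum>i = 1..r. S i j) = (\<Sum>i = 1..r. T i j) + e j * (D / E)"
        by (simp add: S_def sum.distrib D_def sum_distrib_left sum_divide_distrib mult.commute)
      also have "e j * (D / E) \<le> e j * 1"
        using e[OF j] D0 DE by (intro mult_left_mono) (auto simp: divide_le_eq_1)
      finally show ?thesis by (simp add: e_def)
    qed
  qed
qed

text \<open>A row-stochastic \<open>S\<close> above \<open>\<bar>M\<bar>\<close> gives the splitting of \<open>M\<close> into \<open>(S + M) / 2\<close> and
\<open>(S - M) / 2\<close>, whose sum is again \<open>S\<close>. The positive and negative parts of \<open>M\<close> would not do,
because the rows of their sum may have mass less than \<open>1\<close>.\<close>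

lemma polar_inequality_substochastic:
  fixes M T :: "nat \<Rightarrow> nat \<Rightarrow> real"
  assumes rs: "r \<le> s"
    and \<sigma>: "antimono_on {1..r} \<sigma>" "\<forall>i \<in> {1..r}. 0 < \<sigma> i"
    and \<sigma>': "antimono_on {1..s} \<sigma>'" "\<forall>i \<in> {1..s}. 0 < \<sigma>' i"
    and MT: "\<And>i j. i \<in> {1..r} \<Longrightarrow> j \<in> {1..s} \<Longrightarrow> \<bar>M i j\<bar> \<le> T i j"
    and rows: "\<And>i. i \<in> {1..r} \<Longrightarrow> (\<Sum>j = 1..s. T i j) \<le> 1"
    and cols: "\<And>j. j \<in> {1..s} \<Longrightarrow> (\<Sum>i = 1..r. T i j) \<le> 1"
    and \<rho>: "0 \<le> \<rho>" "\<And>k. k \<le> r \<Longrightarrow> \<rho> * polar_den r s \<sigma> \<sigma>' k \<le> polar_num r s k"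
  shows "\<rho> * ((\<Sum>i = 1..r. (\<sigma> i)\<^sup>2) + (\<Sum>j = 1..s. (\<sigma>' j)\<^sup>2)
            - 2 * (\<Sum>i = 1..r. \<Sum>j = 1..s. \<sigma> i * \<sigma>' j * M i j))
         \<le> real r + real s - 2 * (\<Sum>i = 1..r. \<Sum>j = 1..s. M i j)"
proof -
  obtain S where S: "\<And>i j. i \<in> {1..r} \<Longrightarrow> j \<in> {1..s} \<Longrightarrow> T i j \<le> S i j"
    "\<And>i. i \<in> {1..r} \<Longrightarrow> (\<Sum>j = 1..s. S i j) = 1"
    "\<And>j. j \<in> {1..s} \<Longrightarrow> (\<Sum>i = 1..r. S i j) \<le> 1"
    using substochastic_completion[OF rs rows cols] by blast
  define P where "P i j = (S i j + M i j) / 2" for i j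
  define N where "N i j = (S i j - M i j) / 2" for i j
  have PN: "P i j + N i j = S i j" "P i j - N i j = M i j" for i j
    by (simp_all add: P_def N_def field_simps)
  have nonneg: "0 \<le> P i j \<and> 0 \<le> N i j" if "i \<in> {1..r}" "j \<in> {1..s}" for i j
    using MT[OF that] S(1)[OF that] by (auto simp: P_def N_def)
  show ?thesis
    using polar_inequality_row_stochastic[OF rs \<sigma> \<sigma>', of P N \<rho>] S nonneg \<rho> unfolding PN by blast
qed

section \<open>Overlaps of orthonormal families and Frobenius distances\<close>

text \<open>Families are indexed from \<open>1\<close>, like the singular values, and vectors are coordinate functions on
\<open>{..<n}\<close>.\<close>

definition orthonormal :: "nat \<Rightarrow> nat \<Rightarrow> (nat \<Rightarrow> nat \<Rightarrow> complex) \<Rightarrow> bool" where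
  "orthonormal n r u \<longleftrightarrow> (\<forall>i\<in>{1..r}. \<forall>j\<in>{1..r}. (\<Sum>p<n. u i p * cnj (u j p)) = of_bool (i = j))"

lemma orthonormalD:
  "orthonormal n r u \<Longrightarrow> i \<in> {1..r} \<Longrightarrow> j \<in> {1..r} \<Longrightarrow> (\<Sum>p<n. u i p * cnj (u j p)) = of_bool (i = j)"
  unfolding orthonormal_def by blast

text \<open>The deficit is the squared distance of \<open>x\<close> from its projection \<open>y\<close>.\<close>

lemma Bessel_inequality:
  assumes u: "orthonormal n r u"
  shows "(\<Sum>i = 1..r. (cmod (\<Sum>p<n. x p * cnj (u i p)))\<^sup>2) \<le> (\<Sum>p<n. (cmod (x p))\<^sup>2)"
proof -
  define c where "c i = (\<Sum>p<n. x p * cnj (u i p))" for i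
  define y where "y p = (\<Sum>i = 1..r. c i * u i p)" for p
  have xy: "(\<Sum>p<n. x p * cnj (y p)) = (\<Sum>i = 1..r. c i * cnj (c i))"
  proof -
    have "(\<Sum>p<n. x p * cnj (y p)) = (\<Sum>p<n. \<Sum>i = 1..r. cnj (c i) * (x p * cnj (u i p)))"
      by (simp add: y_def sum_distrib_left algebra_simps)
    also have "\<dots> = (\<Sum>i = 1..r. \<Sum>p<n. cnj (c i) * (x p * cnj (u i p)))" by (rule sum.swap)
    also have "\<dots> = (\<Sum>i = 1..r. cnj (c i) * c i)" by (simp add: sum_distrib_left c_def)
    finally show ?thesis by (simp add: mult.commute)
  qed
  have yy: "(\<Sum>p<n. y p * cnj (y p)) = (\<Sum>i = 1..r. c i * cnj (c i))"
  proof -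
    have "(\<Sum>p<n. y p * cnj (y p)) = (\<Sum>p<n. \<Sum>i = 1..r. c i * (u i p * cnj (y p)))"
      by (intro sum.cong refl, subst (1) y_def) (simp add: sum_distrib_right mult.assoc)
    also have "\<dots> = (\<Sum>i = 1..r. c i * (\<Sum>p<n. u i p * cnj (y p)))" 
      by (subst sum.swap) (simp add: sum_distrib_left)
    also have "\<dots> = (\<Sum>i = 1..r. c i * cnj (c i))"
    proof (intro sum.cong refl arg_cong2[of _ _ _ _ "(*)"])
      fix i assume i: "i \<in> {1..r}"
      have "(\<Sum>p<n. u i p * cnj (y p)) = (\<Sum>p<n. \<Sum>j = 1..r. cnj (c j) * (u i p * cnj (u j p)))"
        by (simp add: y_def sum_distrib_left algebra_simps)
      also have "\<dots> = (\<Sum>j = 1..r. cnj (c j) * (\<Sum>p<n. u i p * cnj (u j p)))"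
        by (subst sum.swap) (simp add: sum_distrib_left)
      also have "\<dots> = (\<Sum>j = 1..r. if j = i then cnj (c j) else 0)"
        using orthonormalD[OF u i] by (intro sum.cong) auto
      also have "\<dots> = cnj (c i)" using i by simp
      finally show "(\<Sum>p<n. u i p * cnj (y p)) = cnj (c i)" .
    qed
    finally show ?thesis .
  qed
  have sq: "complex_of_real (\<Sum>p\<in>I. (cmod (f p))\<^sup>2) = (\<Sum>p\<in>I. f p * cnj (f p))" for I and f :: "nat \<Rightarrow> complex"
    by (simp add: complex_norm_square del: of_real_power)
  have yx: "(\<Sum>p<n. y p * cnj (x p)) = (\<Sum>i = 1..r. c i * cnj (c i))"
    using arg_cong[OF xy, of cnj] by (simp add: mult.commute)
  have "complex_of_real (\<Sum>p<n. (cmod (x p - y p))\<^sup>2) = (\<Sum>p<n. x p * cnj (x p)) - (\<Sum>i = 1..r. c i * cnj (c i))"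
    unfolding sq using xy yx yy by (simp add: algebra_simps sum.distrib sum_subtractf)
  also have "\<dots> = complex_of_real ((\<Sum>p<n. (cmod (x p))\<^sup>2) - (\<Sum>i = 1..r. (cmod (c i))\<^sup>2))"
    by (simp only: sq of_real_diff)
  finally have "(\<Sum>p<n. (cmod (x p - y p))\<^sup>2) = (\<Sum>p<n. (cmod (x p))\<^sup>2) - (\<Sum>i = 1..r. (cmod (c i))\<^sup>2)"
    by (simp only: of_real_eq_iff)
  moreover have "0 \<le> (\<Sum>p<n. (cmod (x p - y p))\<^sup>2)" by (intro sum_nonneg) auto
  ultimately show ?thesis by (simp add: c_def)
qed

lemma orthonormal_norm:
  assumes "orthonormal n r u" "i \<in> {1..r}"
  shows "(\<Sum>p<n. (cmod (u i p))\<^sup>2) = 1"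
proof -
  have "complex_of_real (\<Sum>p<n. (cmod (u i p))\<^sup>2) = 1"
    using orthonormalD[OF assms(1,2,2)] by (simp add: complex_norm_square del: of_real_power)
  then show ?thesis by (simp only: of_real_eq_1_iff)
qed

text \<open>Bessel's inequality for each vector of one family against the other family.\<close>

lemma orthonormal_overlaps_substochastic:
  assumes u: "orthonormal n r u" and u': "orthonormal n s u'"
  shows "i \<in> {1..r} \<Longrightarrow> (\<Sum>j = 1..s. (cmod (\<Sum>p<n. u i p * cnj (u' j p)))\<^sup>2) \<le> 1"
    and "j \<in> {1..s} \<Longrightarrow> (\<Sum>i = 1..r. (cmod (\<Sum>p<n. u i p * cnj (u' j p)))\<^sup>2) \<le> 1"
proof -
  show "i \<in> {1..r} \<Longrightarrow> (\<Sum>j = 1..s. (cmod (\<Sum>p<n. u i p * cnj (u' j p)))\<^sup>2) \<le> 1"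
    using Bessel_inequality[OF u', of "u i"] orthonormal_norm[OF u] by simp
  have "cmod (\<Sum>p<n. u i p * cnj (u' j p)) = cmod (\<Sum>p<n. u' j p * cnj (u i p))" for i
    by (subst complex_mod_cnj[symmetric]) (simp add: mult.commute)
  then show "j \<in> {1..s} \<Longrightarrow> (\<Sum>i = 1..r. (cmod (\<Sum>p<n. u i p * cnj (u' j p)))\<^sup>2) \<le> 1"
    using Bessel_inequality[OF u, of "u' j"] orthonormal_norm[OF u'] by simp
qed

definition singular_expansion ::
  "nat \<Rightarrow> nat \<Rightarrow> nat \<Rightarrow> (nat \<Rightarrow> real) \<Rightarrow> (nat \<Rightarrow> nat \<Rightarrow> complex) \<Rightarrow> (nat \<Rightarrow> nat \<Rightarrow> complex) \<Rightarrow> complex mat" where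
  "singular_expansion m n r x u v = mat m n (\<lambda>(p, q). \<Sum>i = 1..r. of_real (x i) * u i p * cnj (v i q))"

lemma singular_expansion_inner:
  "(\<Sum>p<m. \<Sum>q<n. (\<Sum>i = 1..r. of_real (x i) * u i p * cnj (v i q)) *
        cnj (\<Sum>j = 1..s. of_real (y j) * u' j p * cnj (v' j q)))
   = (\<Sum>i = 1..r. \<Sum>j = 1..s. of_real (x i * y j) *
        ((\<Sum>p<m. u i p * cnj (u' j p)) * cnj (\<Sum>q<n. v i q * cnj (v' j q))))"
proof -
  have "(\<Sum>p<m. \<Sum>q<n. (\<Sum>i = 1..r. of_real (x i) * u i p * cnj (v i q)) *
        cnj (\<Sum>j = 1..s. of_real (y j) * u' j p * cnj (v' j q)))
    = (\<Sum>p<m. \<Sum>q<n. \<Sum>i = 1..r. \<Sum>j = 1..s. of_real (x i * y j) *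
        (u i p * cnj (u' j p)) * cnj (v i q * cnj (v' j q)))"
    by (simp add: sum_product algebra_simps)
  also have "\<dots> = (\<Sum>p<m. \<Sum>i = 1..r. \<Sum>q<n. \<Sum>j = 1..s. of_real (x i * y j) *
        (u i p * cnj (u' j p)) * cnj (v i q * cnj (v' j q)))"
    by (rule sum.cong[OF refl], rule sum.swap)
  also have "\<dots> = (\<Sum>i = 1..r. \<Sum>p<m. \<Sum>q<n. \<Sum>j = 1..s. of_real (x i * y j) *
        (u i p * cnj (u' j p)) * cnj (v i q * cnj (v' j q)))"
    by (rule sum.swap)
  also have "\<dots> = (\<Sum>i = 1..r. \<Sum>p<m. \<Sum>j = 1..s. \<Sum>q<n. of_real (x i * y j) *
        (u i p * cnj (u' j p)) * cnj (v i q * cnj (v' j q)))"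
    by (rule sum.cong[OF refl], rule sum.cong[OF refl], rule sum.swap)
  also have "\<dots> = (\<Sum>i = 1..r. \<Sum>j = 1..s. \<Sum>p<m. \<Sum>q<n. of_real (x i * y j) *
        (u i p * cnj (u' j p)) * cnj (v i q * cnj (v' j q)))"
    by (rule sum.cong[OF refl], rule sum.swap)
  also have "\<dots> = (\<Sum>i = 1..r. \<Sum>j = 1..s. of_real (x i * y j) *
        ((\<Sum>p<m. u i p * cnj (u' j p)) * cnj (\<Sum>q<n. v i q * cnj (v' j q))))"
    unfolding cnj_sum sum_product by (simp add: sum_distrib_left mult.assoc)
  finally show ?thesis .
qed

text \<open>The mixed terms involve the two pairs of families only through the overlaps of left and of right
vectors. Since these do not depend on the weights \<open>x\<close> and \<open>y\<close>, the same overlaps govern the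
distance of the matrices and the distance of their polar factors.\<close>

lemma frobenius_norm_singular_expansion_diff:
  assumes u: "orthonormal m r u" and v: "orthonormal n r v"
    and u': "orthonormal m s u'" and v': "orthonormal n s v'"
  shows "(frobenius_norm (singular_expansion m n r x u v - singular_expansion m n s y u' v'))\<^sup>2 =
     (\<Sum>i = 1..r. (x i)\<^sup>2) + (\<Sum>j = 1..s. (y j)\<^sup>2) - 2 * (\<Sum>i = 1..r. \<Sum>j = 1..s. x i * y j *
        Re ((\<Sum>p<m. u i p * cnj (u' j p)) * cnj (\<Sum>q<n. v i q * cnj (v' j q))))"
proof -
  define X where "X p q = (\<Sum>i = 1..r. of_real (x i) * u i p * cnj (v i q))" for p q
  define Y where "Y p q = (\<Sum>j = 1..s. of_real (y j) * u' j p * cnj (v' j q))" for p q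
  have self: "(\<Sum>i = 1..t. \<Sum>j = 1..t. complex_of_real (z i * z j) *
      ((\<Sum>p<m. a i p * cnj (a j p)) * cnj (\<Sum>q<n. b i q * cnj (b j q)))) = of_real (\<Sum>i = 1..t. (z i)\<^sup>2)"
    if "orthonormal m t a" "orthonormal n t b" for t z a b
  proof -
    have "(\<Sum>i = 1..t. \<Sum>j = 1..t. complex_of_real (z i * z j) *
      ((\<Sum>p<m. a i p * cnj (a j p)) * cnj (\<Sum>q<n. b i q * cnj (b j q))))
      = (\<Sum>i = 1..t. \<Sum>j = 1..t. if j = i then complex_of_real (z i * z j) else 0)"
      by (intro sum.cong refl) (simp add: orthonormalD[OF that(1)] orthonormalD[OF that(2)])
    then show ?thesis by (simp add: power2_eq_square)
  qed
  have cm: "(cmod (a - b))\<^sup>2 = Re (a * cnj a) + Re (b * cnj b) - 2 * Re (a * cnj b)" for a b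
    unfolding cmod_power2 by (simp add: power2_eq_square algebra_simps)
  have "(frobenius_norm (singular_expansion m n r x u v - singular_expansion m n s y u' v'))\<^sup>2
    = (\<Sum>p<m. \<Sum>q<n. (cmod (X p q - Y p q))\<^sup>2)"
    by (simp add: frobenius_norm_def singular_expansion_def X_def Y_def sum_nonneg)
  also have "\<dots> = Re (\<Sum>p<m. \<Sum>q<n. X p q * cnj (X p q)) + Re (\<Sum>p<m. \<Sum>q<n. Y p q * cnj (Y p q))
      - 2 * Re (\<Sum>p<m. \<Sum>q<n. X p q * cnj (Y p q))"
    unfolding cm Re_sum by (simp add: sum.distrib sum_subtractf sum_distrib_left)
  also have "Re (\<Sum>p<m. \<Sum>q<n. X p q * cnj (X p q)) = (\<Sum>i = 1..r. (x i)\<^sup>2)"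
    unfolding X_def singular_expansion_inner self[OF u v] by simp
  also have "Re (\<Sum>p<m. \<Sum>q<n. Y p q * cnj (Y p q)) = (\<Sum>i = 1..s. (y i)\<^sup>2)"
    unfolding Y_def singular_expansion_inner self[OF u' v'] by simp
  also have "Re (\<Sum>p<m. \<Sum>q<n. X p q * cnj (Y p q)) = (\<Sum>i = 1..r. \<Sum>j = 1..s. x i * y j *
        Re ((\<Sum>p<m. u i p * cnj (u' j p)) * cnj (\<Sum>q<n. v i q * cnj (v' j q))))"
    unfolding X_def Y_def singular_expansion_inner Re_sum
    by (intro sum.cong refl) (simp add: algebra_simps)
  finally show ?thesis .
qed

section \<open>Unitary diagonalization of Hermitian matrices\<close>

lemma mat_adjoint_carrier [simp]:
  "A \<in> carrier_mat m n \<Longrightarrow> mat_adjoint A \<in> carrier_mat n m"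
  "dim_row (mat_adjoint A) = dim_col A" "dim_col (mat_adjoint A) = dim_row A"
  by (auto simp: mat_adjoint_def)

lemma index_mat_adjoint [simp]:
  "i < dim_col A \<Longrightarrow> j < dim_row A \<Longrightarrow> mat_adjoint A $$ (i, j) = cnj (A $$ (j, i))"
  by (simp add: mat_adjoint_def mat_of_rows_index)

lemma mat_adjoint_mult:
  assumes "(A :: complex mat) \<in> carrier_mat l m" "B \<in> carrier_mat m n"
  shows "mat_adjoint (A * B) = mat_adjoint B * mat_adjoint A"
  using assms by (intro eq_matI) (auto simp: scalar_prod_def mult.commute intro!: sum.cong)

lemma mat_adjoint_adjoint [simp]: "mat_adjoint (mat_adjoint A) = (A :: complex mat)"
  by (intro eq_matI) auto

lemma cscalar_mult_mat_vec:
  assumes "(A :: complex mat) \<in> carrier_mat m n" "x \<in> carrier_vec n" "y \<in> carrier_vec m"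
  shows "(A *\<^sub>v x) \<bullet>c y = x \<bullet>c (mat_adjoint A *\<^sub>v y)"
proof -
  have "(A *\<^sub>v x) \<bullet>c y = (\<Sum>i<m. \<Sum>j<n. A $$ (i, j) * x $ j * cnj (y $ i))"
    using assms by (auto simp: scalar_prod_def sum_distrib_right atLeast0LessThan)
  also have "\<dots> = (\<Sum>j<n. \<Sum>i<m. A $$ (i, j) * x $ j * cnj (y $ i))" by (rule sum.swap)
  also have "\<dots> = x \<bullet>c (mat_adjoint A *\<^sub>v y)"
    using assms by (auto simp: scalar_prod_def sum_distrib_left atLeast0LessThan algebra_simps intro!: sum.cong)
  finally show ?thesis .
qed

lemma cscalar_self: "x \<bullet>c x = of_real (\<Sum>i<dim_vec x. (cmod (x $ i))\<^sup>2)"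
  by (simp add: scalar_prod_def complex_norm_square atLeast0LessThan del: of_real_power)

text \<open>Complete \<open>v\<close> to a basis, orthogonalize, and divide every column by its length.\<close>

lemma unitary_matrix_with_first_column:
  assumes v: "v \<in> carrier_vec n" "v \<noteq> 0\<^sub>v n" and n: "0 < n"
  obtains W :: "complex mat" and c where "W \<in> carrier_mat n n" "mat_adjoint W * W = 1\<^sub>m n" "col W 0 = c \<cdot>\<^sub>v v"
proof -
  interpret cof_vec_space n "TYPE(complex)" .
  define b where "b = basis_completion v"
  define ws where "ws = gram_schmidt n b"
  note bc = basis_completion[OF v, folded b_def]
  note gs = gram_schmidt_result[OF bc(2) bc(4) bc(5) ws_def]
  have len: "length ws = n" using gs(4) bc(6) by simp
  obtain bs where "b = v # bs" using bc(6,7) n by (cases b) auto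
  then have "hd ws = v" using gram_schmidt_hd[OF v(1)] by (simp add: ws_def)
  then have ws0: "ws ! 0 = v" using len n by (cases ws) auto
  have wsi: "ws ! i \<in> carrier_vec n" if "i < n" for i using gs(3) len that by auto
  define c where "c i = complex_of_real (1 / sqrt (Re (ws ! i \<bullet>c ws ! i)))" for i
  define W where "W = mat_of_cols n (map (\<lambda>i. c i \<cdot>\<^sub>v ws ! i) [0..<n])"
  have col: "col W i = c i \<cdot>\<^sub>v ws ! i" if "i < n" for i
    using that wsi unfolding W_def by (subst col_mat_of_cols) auto
  have W: "W \<in> carrier_mat n n" by (simp add: W_def mat_of_cols_def)
  have "(mat_adjoint W * W) $$ (i, j) = 1\<^sub>m n $$ (i, j)" if ij: "i < n" "j < n" for i j
  proof -
    have "(mat_adjoint W * W) $$ (i, j) = col W j \<bullet>c col W i"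
      using W ij by (auto simp: scalar_prod_def intro!: sum.cong)
    also have "\<dots> = c j * cnj (c i) * (ws ! j \<bullet>c ws ! i)"
      using wsi ij by (simp add: col conjugate_smult_vec smult_scalar_prod_distrib[of _ n]
          scalar_prod_smult_distrib[of _ n])
    also have "\<dots> = (if i = j then 1 else 0)"
    proof (cases "i = j")
      case True
      define x where "x = (\<Sum>l<dim_vec (ws ! i). (cmod (ws ! i $ l))\<^sup>2)"
      have "ws ! i \<bullet>c ws ! i \<noteq> 0" using corthogonalD[OF gs(2), of i i] len ij by simp
      moreover have xx: "ws ! i \<bullet>c ws ! i = of_real x" unfolding x_def by (rule cscalar_self)
      ultimately have "x \<noteq> 0" by auto
      moreover have "0 \<le> x" by (simp add: x_def sum_nonneg)
      ultimately have x: "ws ! i \<bullet>c ws ! i = of_real x" "0 < x" using xx by auto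
      have "c i * cnj (c i) = of_real (1 / x)"
        using x(2) unfolding c_def x(1) Re_complex_of_real complex_cnj_complex_of_real of_real_mult[symmetric]
        by (simp add: real_sqrt_mult_self flip: times_divide_times_eq)
      then show ?thesis using True x by simp
    next
      case False
      then have "ws ! j \<bullet>c ws ! i = 0" using corthogonalD[OF gs(2), of j i] len ij by simp
      then show ?thesis using False by simp
    qed
    finally show ?thesis using ij by simp
  qed
  then have "mat_adjoint W * W = 1\<^sub>m n" using W by (intro eq_matI) auto
  then show thesis using that[OF W] col[OF n] ws0 by simp
qed

text \<open>The spectral theorem, with the eigenvalues in a prescribed order. Conjugation with a unitary
matrix whose first column is an eigenvector makes the first column of \<open>A\<close> a multiple of the
first unit vector, and then the first row too, since the matrix stays Hermitian. The induction
continues in the complementary block.\<close>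

lemma hermitian_unitary_diagonalization:
  fixes A :: "complex mat"
  assumes "A \<in> carrier_mat n n" "mat_adjoint A = A" "char_poly A = (\<Prod>e \<leftarrow> es. [:- e, 1:])"
  shows "\<exists>U \<in> carrier_mat n n. mat_adjoint U * U = 1\<^sub>m n \<and>
           mat_adjoint U * A * U = mat n n (\<lambda>(i, j). if i = j then es ! i else 0)"
  using assms
proof (induction es arbitrary: n A)
  case Nil
  then have "n = 0" using degree_monic_char_poly[OF Nil.prems(1)] by simp
  then show ?case by (intro bexI[of _ "1\<^sub>m n"]) auto
next
  case (Cons e es n A)
  note A = Cons.prems(1)
  have "monic (\<Prod>e \<leftarrow> es. [:- e, 1:])" by (rule monic_prod_list) auto
  then have "degree (char_poly A) = Suc (degree (\<Prod>e \<leftarrow> es. [:- e, 1:]))"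
    unfolding Cons.prems(3) list.map prod_list.Cons by (subst degree_mult_eq) auto
  then obtain n' where n: "n = Suc n'" using degree_monic_char_poly[OF A] by (cases n) auto
  have "eigenvalue A e" unfolding eigenvalue_root_char_poly[OF A] Cons.prems(3) by simp
  then obtain v where v: "v \<in> carrier_vec n" "v \<noteq> 0\<^sub>v n" "A *\<^sub>v v = e \<cdot>\<^sub>v v"
    using A by (auto simp: eigenvalue_def eigenvector_def)
  obtain W c where W: "W \<in> carrier_mat n n" "mat_adjoint W * W = 1\<^sub>m n" "col W 0 = c \<cdot>\<^sub>v v"
    using unitary_matrix_with_first_column[OF v(1,2)] n by blast
  have W': "mat_adjoint W \<in> carrier_mat n n" using W by simp
  have WW': "W * mat_adjoint W = 1\<^sub>m n" using mat_mult_left_right_inverse[OF W' W(1,2)] .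
  define A' where "A' = mat_adjoint W * A * W"
  have A': "A' \<in> carrier_mat n n" using A W(1) W' unfolding A'_def by (intro mult_carrier_mat[of _ n n])
  have herm: "mat_adjoint A' = A'"
    unfolding A'_def using A W W' Cons.prems(2)
    by (simp add: mat_adjoint_mult[of _ n n _ n] assoc_mult_mat[of _ n n _ n _ n] mult_carrier_mat[of _ n n _ n])
  have col0: "A' $$ (i, 0) = (if i = 0 then e else 0)" if i: "i < n" for i
  proof -
    have "A' = mat_adjoint W * (A * W)" unfolding A'_def by (rule assoc_mult_mat[OF W' A W(1)])
    then have "A' $$ (i, 0) = (mat_adjoint W *\<^sub>v (A *\<^sub>v col W 0)) $ i"
      using A W W' i n by (simp add: mult_mat_vec_def[of A])
    also have "A *\<^sub>v col W 0 = e \<cdot>\<^sub>v col W 0"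
      using A v by (simp add: W(3) mult_mat_vec[of A n n] smult_smult_assoc mult.commute)
    also have "(mat_adjoint W *\<^sub>v (e \<cdot>\<^sub>v col W 0)) $ i = e * (mat_adjoint W * W) $$ (i, 0)"
      using W(1) W' i n by (simp add: mult_mat_vec[of _ n n])
    also have "\<dots> = (if i = 0 then e else 0)" using i n by (simp add: W(2))
    finally show ?thesis .
  qed
  have row0: "A' $$ (0, i) = (if i = 0 then e else 0)" if i: "i < n" for i
  proof -
    have "A' $$ (0, i) = cnj (A' $$ (i, 0))"
      using A' i n by (subst herm[symmetric]) (simp del: herm)
    moreover have "cnj (A' $$ (0, 0)) = A' $$ (0, 0)"
      using A' n by (subst (2) herm[symmetric]) simp
    ultimately show ?thesis using col0[OF i] col0[of 0] n by (auto split: if_splits)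
  qed
  define A3 where "A3 = mat n' n' (\<lambda>(i, j). A' $$ (Suc i, Suc j))"
  define E where "E = mat 1 1 (\<lambda>_. e)"
  have A3: "A3 \<in> carrier_mat n' n'" and E: "E \<in> carrier_mat 1 1" by (auto simp: A3_def E_def)
  have block: "A' = four_block_mat E (0\<^sub>m 1 n') (0\<^sub>m n' 1) A3"
    using A' col0 row0 n by (intro eq_matI) (auto simp: A3_def E_def)
  have herm3: "mat_adjoint A3 = A3"
  proof (rule eq_matI)
    fix i j assume "i < dim_row A3" "j < dim_col A3"
    then have "i < n'" "j < n'" by (auto simp: A3_def)
    then show "mat_adjoint A3 $$ (i, j) = A3 $$ (i, j)"
      using A' n by (subst (2) A3_def, subst herm[symmetric]) (simp add: A3_def)
  qed (auto simp: A3_def)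
  have "similar_mat A' A"
    unfolding similar_mat_def using A A' W W' WW'
    by (intro exI[of _ "mat_adjoint W"] exI[of _ W] similar_mat_witI[of _ _ n]) (auto simp: A'_def)
  then have "char_poly A' = [:- e, 1:] * (\<Prod>e \<leftarrow> es. [:- e, 1:])"
    using char_poly_similar[of A' A] Cons.prems(3) by simp
  moreover have "char_poly A' = char_poly E * char_poly A3"
    unfolding block by (rule char_poly_four_block_zeros_col[OF E _ A3]) simp
  moreover have "char_poly E = [:- e, 1:]"
    by (simp add: E_def char_poly_defs det_def sign_def)
  ultimately have "char_poly A3 = (\<Prod>e \<leftarrow> es. [:- e, 1:])"
    by (metis mult_cancel_left pCons_eq_0_iff zero_neq_one)
  from Cons.IH[OF A3 herm3 this] obtain U3 where U3: "U3 \<in> carrier_mat n' n'"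
    "mat_adjoint U3 * U3 = 1\<^sub>m n'"
    "mat_adjoint U3 * A3 * U3 = mat n' n' (\<lambda>(i, j). if i = j then es ! i else 0)"
    by blast
  have U3': "mat_adjoint U3 \<in> carrier_mat n' n'" using U3 by simp
  define V where "V = four_block_mat (1\<^sub>m 1) (0\<^sub>m 1 n') (0\<^sub>m n' 1) U3"
  have V: "V \<in> carrier_mat n n" unfolding V_def n using U3 by auto
  have V': "mat_adjoint V = four_block_mat (1\<^sub>m 1) (0\<^sub>m 1 n') (0\<^sub>m n' 1) (mat_adjoint U3)"
    using U3 U3' by (intro eq_matI) (auto simp: V_def)
  have V'c: "mat_adjoint V \<in> carrier_mat n n" using V by simp
  have diagonal_blocks: "four_block_mat X (0\<^sub>m 1 n') (0\<^sub>m n' 1) Y * four_block_mat X' (0\<^sub>m 1 n') (0\<^sub>m n' 1) Y'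
      = four_block_mat (X * X') (0\<^sub>m 1 n') (0\<^sub>m n' 1) (Y * Y')"
    if "X \<in> carrier_mat 1 1" "X' \<in> carrier_mat 1 1" "Y \<in> carrier_mat n' n'" "Y' \<in> carrier_mat n' n'"
    for X X' Y Y' :: "complex mat"
  proof -
    have "X * X' \<in> carrier_mat 1 1" "Y * Y' \<in> carrier_mat n' n'" using that by auto
    then show ?thesis
      using that by (subst mult_four_block_mat[where ?n1.0 = 1 and ?n2.0 = n']) auto
  qed
  have VV: "mat_adjoint V * V = 1\<^sub>m n"
    unfolding V' unfolding V_def diagonal_blocks[OF one_carrier_mat one_carrier_mat U3' U3(1)] U3(2) n
    by (intro eq_matI) auto
  have c: "mat_adjoint U3 * A3 \<in> carrier_mat n' n'" using A3 U3' by simp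
  have VAV: "mat_adjoint V * A' * V = four_block_mat E (0\<^sub>m 1 n') (0\<^sub>m n' 1) (mat_adjoint U3 * A3 * U3)"
    unfolding V' block unfolding V_def
    by (subst diagonal_blocks[OF one_carrier_mat E U3' A3],
        subst diagonal_blocks[OF _ one_carrier_mat c U3(1)]) (use E in auto)
  show ?case
  proof (intro bexI[of _ "W * V"] conjI)
    have "mat_adjoint (W * V) * (W * V) = mat_adjoint V * (mat_adjoint W * W) * V"
      using W(1) V W' V'c by (simp add: mat_adjoint_mult[of _ n n _ n] assoc_mult_mat[of _ n n _ n _ n] mult_carrier_mat[of _ n n _ n])
    then show "mat_adjoint (W * V) * (W * V) = 1\<^sub>m n"
      using V V'c VV by (simp add: W(2))
    have "mat_adjoint (W * V) * A * (W * V) = mat_adjoint V * A' * V"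
      using A W(1) V W' V'c 
      by (simp add: A'_def mat_adjoint_mult[of _ n n _ n] assoc_mult_mat[of _ n n _ n _ n] mult_carrier_mat[of _ n n _ n])
    then show "mat_adjoint (W * V) * A * (W * V) = mat n n (\<lambda>(i, j). if i = j then (e # es) ! i else 0)"
      unfolding VAV U3(3) by (auto intro!: eq_matI simp: E_def n nth_Cons')
    show "W * V \<in> carrier_mat n n" using W V by simp
  qed
qed

section \<open>Polar factors in terms of singular vectors\<close>

text \<open>Over the complex numbers the quadratic form determines the sesquilinear form by polarization:
evaluate at \<open>x + y\<close> and at \<open>x + \<i> y\<close>.\<close>

lemma equal_quadratic_forms_imp_equal:
  fixes B C :: "complex mat"
  assumes B: "B \<in> carrier_mat n n" and C: "C \<in> carrier_mat n n"
    and eq: "\<And>x. x \<in> carrier_vec n \<Longrightarrow> (B *\<^sub>v x) \<bullet>c x = (C *\<^sub>v x) \<bullet>c x"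
  shows "B = C"
proof -
  have expand: "(M *\<^sub>v (x + c \<cdot>\<^sub>v y)) \<bullet>c (x + c \<cdot>\<^sub>v y) = (M *\<^sub>v x) \<bullet>c x + c * ((M *\<^sub>v y) \<bullet>c x)
      + cnj c * ((M *\<^sub>v x) \<bullet>c y) + c * cnj c * ((M *\<^sub>v y) \<bullet>c y)"
    if "M \<in> carrier_mat n n" "x \<in> carrier_vec n" "y \<in> carrier_vec n" for M :: "complex mat" and x y c
  proof -
    have [simp]: "M *\<^sub>v x \<in> carrier_vec n" "M *\<^sub>v y \<in> carrier_vec n" using that by auto
    have "M *\<^sub>v (x + c \<cdot>\<^sub>v y) = M *\<^sub>v x + c \<cdot>\<^sub>v (M *\<^sub>v y)"
      using that by (simp add: mult_add_distrib_mat_vec[of _ n n] mult_mat_vec[of _ n n])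
    then show ?thesis
      using that by (simp add: conjugate_add_vec[of _ n] conjugate_smult_vec scalar_prod_add_distrib[of _ n]
          add_scalar_prod_distrib[of _ n] smult_scalar_prod_distrib[of _ n] scalar_prod_smult_distrib[of _ n]
          algebra_simps)
  qed
  have polar: "(B *\<^sub>v x) \<bullet>c y = (C *\<^sub>v x) \<bullet>c y" if xy: "x \<in> carrier_vec n" "y \<in> carrier_vec n" for x y
  proof -
    have c: "c * ((B *\<^sub>v y) \<bullet>c x) + cnj c * ((B *\<^sub>v x) \<bullet>c y)
        = c * ((C *\<^sub>v y) \<bullet>c x) + cnj c * ((C *\<^sub>v x) \<bullet>c y)" for c
    proof -
      have "x + c \<cdot>\<^sub>v y \<in> carrier_vec n" using xy by simp
      from eq[OF this] show ?thesis
        unfolding expand[OF B xy] expand[OF C xy] using eq[OF xy(1)] eq[OF xy(2)] by simp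
    qed
    have "\<i> * ((B *\<^sub>v y) \<bullet>c x - (B *\<^sub>v x) \<bullet>c y) = \<i> * ((C *\<^sub>v y) \<bullet>c x - (C *\<^sub>v x) \<bullet>c y)"
      using c[of \<i>] by (simp add: algebra_simps)
    then have "(B *\<^sub>v y) \<bullet>c x - (B *\<^sub>v x) \<bullet>c y = (C *\<^sub>v y) \<bullet>c x - (C *\<^sub>v x) \<bullet>c y"
      by simp
    moreover have "(B *\<^sub>v y) \<bullet>c x + (B *\<^sub>v x) \<bullet>c y = (C *\<^sub>v y) \<bullet>c x + (C *\<^sub>v x) \<bullet>c y"
      using c[of 1] by simp
    ultimately show ?thesis
      unfolding complex_eq_iff plus_complex.simps minus_complex.simps by linarith
  qed
  have entry: "(M *\<^sub>v unit_vec n j) \<bullet>c unit_vec n i = M $$ (i, j)"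
    if "M \<in> carrier_mat n n" "i < n" "j < n" for M :: "complex mat" and i j
  proof -
    have "conjugate (unit_vec n i :: complex vec) = unit_vec n i"
      by (intro eq_vecI) (auto simp: unit_vec_def)
    then show ?thesis using that by (simp add: scalar_prod_right_unit[of _ n])
  qed
  show ?thesis
    using B C entry[OF B] entry[OF C] polar[OF unit_vec_carrier unit_vec_carrier] by (intro eq_matI) auto
qed

text \<open>For \<open>w = H v - s v\<close> the hypothesis says \<open>H w = - s w\<close>. A positive semidefinite matrix has no
negative eigenvalue, so \<open>w = 0\<close> if \<open>s > 0\<close>; if \<open>s = 0\<close>, then \<open>\<parallel>H v\<parallel>\<^sup>2 = \<langle>H\<^sup>2 v, v\<rangle> = 0\<close>.\<close>

lemma pos_semidef_sqrt_eigenvector: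
  fixes H :: "complex mat"
  assumes H: "H \<in> carrier_mat n n" and psd: "pos_semidef H"
    and v: "v \<in> carrier_vec n" and eigen: "H *\<^sub>v (H *\<^sub>v v) = of_real (s\<^sup>2) \<cdot>\<^sub>v v" and s: "0 \<le> s"
  shows "H *\<^sub>v v = of_real s \<cdot>\<^sub>v v"
proof -
  have adj: "mat_adjoint H = H" and pos: "\<And>x. x \<in> carrier_vec n \<Longrightarrow> 0 \<le> (H *\<^sub>v x) \<bullet>c x"
    using psd H by (auto simp: pos_semidef_def)
  have Hv: "H *\<^sub>v v \<in> carrier_vec n" using H v by simp
  show ?thesis
  proof (cases "s = 0")
    case True
    have "(H *\<^sub>v v) \<bullet>c (H *\<^sub>v v) = v \<bullet>c (H *\<^sub>v (H *\<^sub>v v))"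
      using cscalar_mult_mat_vec[OF H v Hv] by (simp add: adj)
    also have "\<dots> = 0" using v by (simp add: eigen True conjugate_smult_vec)
    finally have "H *\<^sub>v v = 0\<^sub>v n" using Hv by (simp add: conjugate_square_eq_0_vec)
    then show ?thesis using True v by auto
  next
    case False
    define w where "w = H *\<^sub>v v - of_real s \<cdot>\<^sub>v v"
    have w: "w \<in> carrier_vec n" using Hv v by (simp add: w_def)
    have "H *\<^sub>v w = H *\<^sub>v (H *\<^sub>v v) - of_real s \<cdot>\<^sub>v (H *\<^sub>v v)"
      using H Hv v by (simp add: w_def mult_minus_distrib_mat_vec[of _ n n] mult_mat_vec[of _ n n])
    also have "\<dots> = - of_real s \<cdot>\<^sub>v w"
      unfolding eigen w_def using H Hv v by (intro eq_vecI) (auto simp: power2_eq_square algebra_simps)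
    finally have "(H *\<^sub>v w) \<bullet>c w = - of_real s * (w \<bullet>c w)"
      using w by (simp add: smult_scalar_prod_distrib[of _ n])
    with pos[OF w] have "0 \<le> - (of_real s * (w \<bullet>c w))" by simp
    moreover define t where "t = (\<Sum>i<dim_vec w. (cmod (w $ i))\<^sup>2)"
    moreover have ww: "w \<bullet>c w = of_real t" unfolding t_def by (rule cscalar_self)
    ultimately have "s * t \<le> 0" by (simp add: less_eq_complex_def)
    moreover have "0 \<le> t" by (simp add: t_def sum_nonneg)
    ultimately have "t = 0" using s False by (simp add: mult_le_0_iff)
    then have "w \<bullet>c w = 0" using ww by simp
    then have "w = 0\<^sub>v n" using w by (simp add: conjugate_square_eq_0_vec)
    then have "H *\<^sub>v v - of_real s \<cdot>\<^sub>v v = 0\<^sub>v n" by (simp add: w_def)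
    then show ?thesis using Hv v
      by (metis carrier_vecD eq_iff_diff_eq_0 eq_vecI index_minus_vec(1) index_zero_vec(1) smult_carrier_vec)
  qed
qed

text \<open>If \<open>v\<close> is an eigenvector for \<open>z\<close>, then \<open>z \<parallel>v\<parallel>\<^sup>2 = \<parallel>A v\<parallel>\<^sup>2\<close>.\<close>

lemma gram_eigenvalue_nonneg:
  fixes A :: "complex mat"
  assumes A: "A \<in> carrier_mat m n" and z: "eigenvalue (mat_adjoint A * A) z"
  shows "z = of_real ((sqrt (Re z))\<^sup>2)"
proof -
  have A': "mat_adjoint A \<in> carrier_mat n m" using A by simp
  obtain v where v: "v \<in> carrier_vec n" "v \<noteq> 0\<^sub>v n" "(mat_adjoint A * A) *\<^sub>v v = z \<cdot>\<^sub>v v"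
    using z A by (auto simp: eigenvalue_def eigenvector_def)
  have Av: "A *\<^sub>v v \<in> carrier_vec m" using A v by simp
  have "z * (v \<bullet>c v) = (mat_adjoint A *\<^sub>v (A *\<^sub>v v)) \<bullet>c v"
    unfolding assoc_mult_mat_vec[OF A' A v(1), symmetric] v(3)
    using v(1) by (simp add: smult_scalar_prod_distrib[of _ n])
  also have "\<dots> = (A *\<^sub>v v) \<bullet>c (A *\<^sub>v v)"
    using cscalar_mult_mat_vec[OF A' Av v(1)] by simp
  finally have e: "z * (v \<bullet>c v) = (A *\<^sub>v v) \<bullet>c (A *\<^sub>v v)" .
  define x where "x = (\<Sum>l<n. (cmod (v $ l))\<^sup>2)"
  define y where "y = (\<Sum>l<m. (cmod ((A *\<^sub>v v) $ l))\<^sup>2)"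
  have xy: "v \<bullet>c v = of_real x" "(A *\<^sub>v v) \<bullet>c (A *\<^sub>v v) = of_real y"
    using v(1) Av by (simp_all only: x_def y_def cscalar_self carrier_vecD)
  have "x \<noteq> 0" using v(1,2) xy(1) by (metis conjugate_square_eq_0_vec of_real_0)
  have "0 \<le> x" "0 \<le> y" by (simp_all add: x_def y_def sum_nonneg)
  have "z = of_real (y / x)" using e \<open>x \<noteq> 0\<close> unfolding xy by (simp add: field_simps)
  then show ?thesis using \<open>0 \<le> x\<close> \<open>0 \<le> y\<close> by simp
qed

text \<open>The eigenvalues of \<open>A\<^sup>*A\<close> are recovered from the nonzero singular values by squaring and filling
up with zeros to the size \<open>n\<close>; the list fixes the order in which the spectral theorem is
applied.\<close>

lemma char_poly_gram_of_singular_values: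
  fixes A :: "complex mat"
  assumes A: "A \<in> carrier_mat m n"
    and \<sigma>: "nonzero_singular_values A = image_mset \<sigma> (mset_set {1..r})"
  shows "r \<le> n"
    and "char_poly (mat_adjoint A * A) =
      (\<Prod>e \<leftarrow> map (\<lambda>i. of_real ((if i < r then \<sigma> (Suc i) else 0)\<^sup>2)) [0..<n]. [:- e, 1:])"
proof -
  let ?f = "\<lambda>i. complex_of_real ((if i < r then \<sigma> (Suc i) else 0)\<^sup>2)"
  define B where "B = mat_adjoint A * A"
  define M where "M = proots (char_poly B)"
  have B: "B \<in> carrier_mat n n" unfolding B_def using A by (intro mult_carrier_mat[of _ n m]) simp_all
  have monic: "degree (char_poly B) = n" "lead_coeff (char_poly B) = 1"
    using degree_monic_char_poly[OF B] by auto
  have decomp: "char_poly B = (\<Prod>x\<in>#M. [:-x, 1:])"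
    using complex_poly_decompose_multiset[of "char_poly B"] monic by (simp add: M_def)
  have size: "size M = n" using size_proots_complex[of "char_poly B"] monic by (simp add: M_def)
  have "char_poly B \<noteq> 0" using monic(2) by auto
  then have "z = of_real ((sqrt (Re z))\<^sup>2)" if "z \<in># M" for z
    using that gram_eigenvalue_nonneg[OF A, folded B_def, of z] eigenvalue_root_char_poly[OF B]
    by (simp add: M_def)
  then have "M = image_mset (\<lambda>z. of_real ((sqrt (Re z))\<^sup>2)) M"
    by (subst (1) image_mset_cong[of M id, symmetric, unfolded image_mset.id id_apply]) (auto simp: id_def)
  also have "\<dots> = image_mset (\<lambda>x. of_real (x\<^sup>2)) (singular_values A)"
    by (simp add: singular_values_def M_def B_def multiset.map_comp comp_def)
  also have "singular_values A = nonzero_singular_values A + filter_mset (\<lambda>x. x = 0) (singular_values A)"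
    unfolding nonzero_singular_values_def using multiset_partition[of "singular_values A" "\<lambda>x. x \<noteq> 0"] by simp
  also have "filter_mset (\<lambda>x. x = 0) (singular_values A) = replicate_mset (count (singular_values A) 0) 0"
    by (rule filter_eq_replicate_mset)
  finally have M: "M = image_mset (\<lambda>i. of_real ((\<sigma> i)\<^sup>2)) (mset_set {1..r}) + replicate_mset (count (singular_values A) 0) 0"
    by (simp add: \<sigma> multiset.map_comp comp_def)
  with size have n: "n = r + count (singular_values A) 0" by simp
  then show "r \<le> n" by simp
  have "mset (map ?f [0..<n]) = image_mset ?f (mset_set {0..<r}) + image_mset ?f (mset_set {r..<n})"
    using \<open>r \<le> n\<close> by (simp flip: image_mset_union mset_set_Union add: ivl_disj_un)
  also have "image_mset ?f (mset_set {r..<n}) = image_mset (\<lambda>_. 0) (mset_set {r..<n})"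
    by (rule image_mset_cong) auto
  also have "\<dots> = replicate_mset (count (singular_values A) 0) 0"
    using n by (simp add: image_mset_const_eq)
  also have "image_mset ?f (mset_set {0..<r}) = image_mset (\<lambda>i. of_real ((\<sigma> (Suc i))\<^sup>2)) (mset_set {0..<r})"
    by (rule image_mset_cong) auto
  also have "\<dots> = image_mset (\<lambda>i. of_real ((\<sigma> i)\<^sup>2)) (image_mset Suc (mset_set {0..<r}))"
    by (simp add: multiset.map_comp comp_def)
  also have "image_mset Suc (mset_set {0..<r}) = mset_set {1..r}"
    by (subst image_mset_mset_set) (auto simp: image_Suc_atLeastLessThan atLeastLessThanSuc_atLeastAtMost)
  finally have "mset (map ?f [0..<n]) = M" by (simp only: M)
  then have M: "M = mset (map ?f [0..<n])" by (rule sym)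
  show "char_poly (mat_adjoint A * A) = (\<Prod>e \<leftarrow> map ?f [0..<n]. [:- e, 1:])"
    unfolding B_def[symmetric] decomp
    by (subst M) (simp only: prod_mset_prod_list[symmetric] mset_map)
qed

text \<open>Since \<open>Q\<close> is isometric on the range of \<open>H\<close>, the matrices \<open>A\<^sup>*A\<close> and \<open>H\<^sup>2\<close> have the same quadratic
form, hence are equal, and an orthonormal eigenbasis \<open>v\<close> of \<open>A\<^sup>*A\<close> is one of \<open>H\<close> with the
eigenvalues \<open>\<sigma>\<close>. The left vectors are \<open>Q v\<close>: they vanish where the eigenvalue does, as \<open>v\<close> is
then orthogonal to the range of \<open>H\<close>, which is the range of \<open>Q\<^sup>*\<close>, and the others are orthonormal
because \<open>A v = \<sigma> Q v\<close>.\<close>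

lemma generalized_polar_singular_expansion:
  assumes A: "A \<in> carrier_mat m n" and polar: "generalized_polar A Q H"
    and \<sigma>: "nonzero_singular_values A = image_mset \<sigma> (mset_set {1..r})" "\<forall>i\<in>{1..r}. 0 < \<sigma> i"
  obtains u v where "orthonormal m r u" "orthonormal n r v"
    "A = singular_expansion m n r \<sigma> u v" "Q = singular_expansion m n r (\<lambda>_. 1) u v"
proof -
  have Q: "Q \<in> carrier_mat m n" and H: "H \<in> carrier_mat n n" and psd: "pos_semidef H"
    and sub: "subunitary Q" and AQH: "A = Q * H"
    and range: "vec_space.col_space n (mat_adjoint Q) = vec_space.col_space n H"
    using polar A by (auto simp: generalized_polar_def Let_def cmats_of_rank_def)
  have Q': "mat_adjoint Q \<in> carrier_mat n m" using Q by simp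
  have A': "mat_adjoint A \<in> carrier_mat n m" using A by simp
  have adj: "mat_adjoint H = H" using psd by (simp add: pos_semidef_def)
  have range_H: "\<exists>w \<in> carrier_vec m. H *\<^sub>v z = mat_adjoint Q *\<^sub>v w" if z: "z \<in> carrier_vec n" for z
  proof -
    have "H *\<^sub>v z \<in> vec_space.col_space n H"
      unfolding vec_space.col_space_eq[OF H] using H z by auto
    then obtain w where "w \<in> carrier_vec m" "mat_adjoint Q *\<^sub>v w = H *\<^sub>v z"
      unfolding range[symmetric] vec_space.col_space_eq[OF Q'] using Q by auto
    then show ?thesis by (intro bexI[of _ w]) simp_all
  qed
  have range_Q: "\<exists>z \<in> carrier_vec n. mat_adjoint Q *\<^sub>v w = H *\<^sub>v z" if w: "w \<in> carrier_vec m" for w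
  proof -
    have "mat_adjoint Q *\<^sub>v w \<in> vec_space.col_space n (mat_adjoint Q)"
      unfolding vec_space.col_space_eq[OF Q'] using Q Q' w mult_mat_vec_carrier[OF Q' w] by auto
    then obtain z where "z \<in> carrier_vec n" "H *\<^sub>v z = mat_adjoint Q *\<^sub>v w"
      unfolding range vec_space.col_space_eq[OF H] using H by auto
    then show ?thesis by (intro bexI[of _ z]) simp_all
  qed
  define B where "B = mat_adjoint A * A"
  have B: "B \<in> carrier_mat n n" unfolding B_def by (rule mult_carrier_mat[OF A' A])
  have B_adj: "mat_adjoint B = B"
    unfolding B_def by (simp add: mat_adjoint_mult[OF A' A])
  have HH: "H * H = B"
  proof (rule equal_quadratic_forms_imp_equal[of _ n])
    fix x :: "complex vec" assume x: "x \<in> carrier_vec n"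
    have Hx: "H *\<^sub>v x \<in> carrier_vec n" and Ax: "A *\<^sub>v x \<in> carrier_vec m" using H A x by auto
    obtain w where w: "w \<in> carrier_vec m" "H *\<^sub>v x = mat_adjoint Q *\<^sub>v w" using range_H[OF x] by blast
    have "(H *\<^sub>v x) \<bullet>c y = 0" if "y \<in> mat_kernel Q" for y
    proof -
      note y = mat_kernelD[OF Q that]
      have "(H *\<^sub>v x) \<bullet>c y = w \<bullet>c (Q *\<^sub>v y)"
        using cscalar_mult_mat_vec[OF Q' w(1) y(1)] w(2) by simp
      then show ?thesis using w(1) by (simp add: y(2))
    qed
    then have "(Q *\<^sub>v (H *\<^sub>v x)) \<bullet>c (Q *\<^sub>v (H *\<^sub>v x)) = (H *\<^sub>v x) \<bullet>c (H *\<^sub>v x)"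
      using sub Hx Q by (auto simp: subunitary_def)
    then have "(A *\<^sub>v x) \<bullet>c (A *\<^sub>v x) = (H *\<^sub>v x) \<bullet>c (H *\<^sub>v x)"
      by (simp add: AQH assoc_mult_mat_vec[OF Q H x])
    moreover have "(B *\<^sub>v x) \<bullet>c x = (A *\<^sub>v x) \<bullet>c (A *\<^sub>v x)"
      using cscalar_mult_mat_vec[OF A' Ax x] by (simp add: B_def assoc_mult_mat_vec[OF A' A x])
    moreover have "(H * H *\<^sub>v x) \<bullet>c x = (H *\<^sub>v x) \<bullet>c (H *\<^sub>v x)"
      using cscalar_mult_mat_vec[OF H Hx x] by (simp add: adj assoc_mult_mat_vec[OF H H x])
    ultimately show "(H * H *\<^sub>v x) \<bullet>c x = (B *\<^sub>v x) \<bullet>c x" by simp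
  qed (use H B in auto)
  define s where "s i = (if i < r then \<sigma> (Suc i) else 0)" for i
  have s0: "0 \<le> s i" and s_pos: "i < r \<Longrightarrow> 0 < s i" for i
    using \<sigma>(2) by (auto simp: s_def less_imp_le)
  note cp = char_poly_gram_of_singular_values[OF A \<sigma>(1), folded s_def B_def]
  obtain U where U: "U \<in> carrier_mat n n" "mat_adjoint U * U = 1\<^sub>m n"
    "mat_adjoint U * B * U = mat n n (\<lambda>(i, j). if i = j then map (\<lambda>i. of_real ((s i)\<^sup>2)) [0..<n] ! i else 0)"
    using hermitian_unitary_diagonalization[OF B B_adj cp(2)] by blast
  have U': "mat_adjoint U \<in> carrier_mat n n" using U by simp
  have UU': "U * mat_adjoint U = 1\<^sub>m n" using mat_mult_left_right_inverse[OF U' U(1,2)] .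
  define v where "v i = col U i" for i
  have v: "v i \<in> carrier_vec n" if "i < n" for i using that U by (simp add: v_def)
  have v_orth: "v i \<bullet>c v j = of_bool (i = j)" if ij: "i < n" "j < n" for i j
  proof -
    have "v i \<bullet>c v j = (mat_adjoint U * U) $$ (j, i)"
      using U(1) ij by (auto simp: v_def scalar_prod_def intro!: sum.cong)
    then show ?thesis using ij by (auto simp: U(2))
  qed
  have Bv: "B *\<^sub>v v i = of_real ((s i)\<^sup>2) \<cdot>\<^sub>v v i" if i: "i < n" for i
  proof -
    let ?D = "mat n n (\<lambda>(i, j). if i = j then map (\<lambda>i. complex_of_real ((s i)\<^sup>2)) [0..<n] ! i else 0)"
    have "B * U = (U * mat_adjoint U) * (B * U)"
      using left_mult_one_mat[OF mult_carrier_mat[OF B U(1)]] by (simp add: UU')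
    also have "\<dots> = U * (mat_adjoint U * B * U)"
      using B U(1) U' by (simp add: assoc_mult_mat[of _ n n _ n _ n] mult_carrier_mat[of _ n n _ n])
    finally have BU: "B * U = U * ?D" by (simp only: U(3))
    show ?thesis
    proof (rule eq_vecI)
      fix p assume "p < dim_vec (of_real ((s i)\<^sup>2) \<cdot>\<^sub>v v i)"
      then have p: "p < n" using v[OF i] by simp
      have "(B *\<^sub>v v i) $ p = (B * U) $$ (p, i)" using B U(1) i p by (simp add: v_def)
      also have "\<dots> = (\<Sum>l = 0..<n. U $$ (p, l) * ?D $$ (l, i))"
        unfolding BU using U(1) i p by (simp add: scalar_prod_def)
      also have "\<dots> = (\<Sum>l = 0..<n. if l = i then of_real ((s i)\<^sup>2) * U $$ (p, i) else 0)"
        using i by (intro sum.cong) auto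
      also have "\<dots> = (of_real ((s i)\<^sup>2) \<cdot>\<^sub>v v i) $ p" using i p U(1) by (simp add: v_def)
      finally show "(B *\<^sub>v v i) $ p = (of_real ((s i)\<^sup>2) \<cdot>\<^sub>v v i) $ p" .
    qed (use B U(1) i in \<open>simp add: v_def\<close>)
  qed
  have Hv: "H *\<^sub>v v i = of_real (s i) \<cdot>\<^sub>v v i" if i: "i < n" for i
    using Bv[OF i] s0 assoc_mult_mat_vec[OF H H v[OF i]]
    by (intro pos_semidef_sqrt_eigenvector[OF H psd v[OF i]]) (simp_all add: HH)
  have Qv: "Q *\<^sub>v v i \<in> carrier_vec m" if "i < n" for i using Q v[OF that] by simp
  have Av: "A *\<^sub>v v i = of_real (s i) \<cdot>\<^sub>v (Q *\<^sub>v v i)" if i: "i < n" for i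
    using Q v[OF i] by (simp add: AQH assoc_mult_mat_vec[OF Q H v[OF i]] Hv[OF i] mult_mat_vec[of _ m n])
  have Q0: "Q *\<^sub>v v i = 0\<^sub>v m" if i: "i < n" "r \<le> i" for i
  proof -
    obtain z where z: "z \<in> carrier_vec n" "mat_adjoint Q *\<^sub>v (Q *\<^sub>v v i) = H *\<^sub>v z"
      using range_Q[OF Qv[OF i(1)]] by blast
    have "(Q *\<^sub>v v i) \<bullet>c (Q *\<^sub>v v i) = v i \<bullet>c (H *\<^sub>v z)"
      using cscalar_mult_mat_vec[OF Q v[OF i(1)] Qv[OF i(1)]] z(2) by simp
    also have "\<dots> = (H *\<^sub>v v i) \<bullet>c z"
      using cscalar_mult_mat_vec[OF H v[OF i(1)] z(1)] by (simp add: adj)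
    also have "\<dots> = 0" using i v[OF i(1)] z(1) by (simp add: Hv s_def)
    finally show ?thesis using Qv[OF i(1)] by (simp add: conjugate_square_eq_0_vec)
  qed
  have Q_orth: "(Q *\<^sub>v v i) \<bullet>c (Q *\<^sub>v v j) = of_bool (i = j)" if ij: "i < r" "j < r" for i j
  proof -
    have n: "i < n" "j < n" using ij cp(1) by auto
    have "of_real (s i * s j) * ((Q *\<^sub>v v i) \<bullet>c (Q *\<^sub>v v j)) = (A *\<^sub>v v i) \<bullet>c (A *\<^sub>v v j)"
      unfolding Av[OF n(1)] Av[OF n(2)]
      using Qv[OF n(1)] Qv[OF n(2)] by (simp add: conjugate_smult_vec smult_scalar_prod_distrib[of _ m]
          scalar_prod_smult_distrib[of _ m])
    also have "\<dots> = (B *\<^sub>v v i) \<bullet>c v j"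
      using cscalar_mult_mat_vec[OF A' _ v[OF n(2)], of "A *\<^sub>v v i"] A v[OF n(1)]
      by (simp add: B_def assoc_mult_mat_vec[OF A' A v[OF n(1)]])
    also have "\<dots> = of_real ((s i)\<^sup>2) * of_bool (i = j)"
      using v n by (simp add: Bv v_orth smult_scalar_prod_distrib[of _ n])
    finally show ?thesis using s_pos[OF ij(1)] s_pos[OF ij(2)] by (auto simp: power2_eq_square)
  qed
  \<comment> \<open>Any \<open>X\<close> is the sum of the \<open>(X v) v\<^sup>*\<close> over an orthonormal basis; this is applied to \<open>A\<close> and \<open>Q\<close>.
    The families are shifted by one to be indexed from \<open>1\<close>.\<close>
  have expansion: "X = singular_expansion m n r x (\<lambda>i p. (Q *\<^sub>v v (i - 1)) $ p) (\<lambda>i q. v (i - 1) $ q)"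
    if X: "X \<in> carrier_mat m n"
      and Xv: "\<And>i. i < n \<Longrightarrow> X *\<^sub>v v i = (if i < r then of_real (x (Suc i)) else 0) \<cdot>\<^sub>v (Q *\<^sub>v v i)" for X x
  proof (rule eq_matI)
    let ?S = "singular_expansion m n r x (\<lambda>i p. (Q *\<^sub>v v (i - 1)) $ p) (\<lambda>i q. v (i - 1) $ q)"
    fix p q assume "p < dim_row ?S" "q < dim_col ?S"
    then have pq: "p < m" "q < n" by (auto simp: singular_expansion_def)
    have "X * U * mat_adjoint U = X"
      using X U(1) U' by (simp add: assoc_mult_mat[of _ m n _ n _ n] UU')
    then have "X $$ (p, q) = (X * U * mat_adjoint U) $$ (p, q)" by simp
    also have "\<dots> = (\<Sum>i<n. (X * U) $$ (p, i) * cnj (U $$ (q, i)))"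
      using X U(1) pq by (simp add: scalar_prod_def atLeast0LessThan)
    also have "\<dots> = (\<Sum>i<n. (X *\<^sub>v v i) $ p * cnj (v i $ q))"
      using X U(1) pq by (intro sum.cong refl) (simp add: v_def)
    also have "\<dots> = (\<Sum>i<n. if i < r then of_real (x (Suc i)) * (Q *\<^sub>v v i) $ p * cnj (v i $ q) else 0)"
      using pq Q by (intro sum.cong refl) (simp add: Xv)
    also have "\<dots> = (\<Sum>i<r. of_real (x (Suc i)) * (Q *\<^sub>v v i) $ p * cnj (v i $ q))"
      using cp(1) by (intro sum.mono_neutral_cong_right) auto
    also have "\<dots> = ?S $$ (p, q)"
      using pq by (simp add: singular_expansion_def sum.atLeast1_atMost_eq)
    finally show "X $$ (p, q) = ?S $$ (p, q)" .
  qed (use X in \<open>auto simp: singular_expansion_def\<close>)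
  show thesis
  proof (rule that)
    show "orthonormal m r (\<lambda>i p. (Q *\<^sub>v v (i - 1)) $ p)"
      unfolding orthonormal_def
    proof (intro ballI)
      fix i j assume ij: "i \<in> {1..r}" "j \<in> {1..r}"
      then have "(Q *\<^sub>v v (i - 1)) \<bullet>c (Q *\<^sub>v v (j - 1)) = of_bool (i - 1 = j - 1)"
        by (intro Q_orth) auto
      then show "(\<Sum>p<m. (Q *\<^sub>v v (i - 1)) $ p * cnj ((Q *\<^sub>v v (j - 1)) $ p)) = of_bool (i = j)"
        using ij Q by (simp add: scalar_prod_def atLeast0LessThan) auto
    qed
    show "orthonormal n r (\<lambda>i q. v (i - 1) $ q)"
      unfolding orthonormal_def
    proof (intro ballI)
      fix i j assume ij: "i \<in> {1..r}" "j \<in> {1..r}"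
      then have n: "i - 1 < n" "j - 1 < n" using cp(1) by auto
      show "(\<Sum>q<n. v (i - 1) $ q * cnj (v (j - 1) $ q)) = of_bool (i = j)"
        using v_orth[OF n] carrier_vecD[OF v[OF n(2)]] ij by (simp add: scalar_prod_def atLeast0LessThan) auto
    qed
    show "A = singular_expansion m n r \<sigma> (\<lambda>i p. (Q *\<^sub>v v (i - 1)) $ p) (\<lambda>i q. v (i - 1) $ q)"
      using Av by (intro expansion[OF A]) (auto simp: s_def)
    show "Q = singular_expansion m n r (\<lambda>_. 1) (\<lambda>i p. (Q *\<^sub>v v (i - 1)) $ p) (\<lambda>i q. v (i - 1) $ q)"
      using Q0 Qv by (intro expansion[OF Q]) auto
  qed
qed

section \<open>Rectangular diagonal matrices\<close>

definition rect_diag :: "nat \<Rightarrow> nat \<Rightarrow> (nat \<Rightarrow> real) \<Rightarrow> complex mat" where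
  "rect_diag m n d = mat m n (\<lambda>(i, j). if i = j then of_real (d i) else 0)"

lemma rect_diag_carrier [simp]: "rect_diag m n d \<in> carrier_mat m n"
  and dim_rect_diag [simp]: "dim_row (rect_diag m n d) = m" "dim_col (rect_diag m n d) = n"
  and index_rect_diag [simp]: "i < m \<Longrightarrow> j < n \<Longrightarrow> rect_diag m n d $$ (i, j) = (if i = j then of_real (d i) else 0)"
  by (auto simp: rect_diag_def)

lemma mat_adjoint_rect_diag [simp]: "mat_adjoint (rect_diag m n d) = rect_diag n m d"
  by (intro eq_matI) auto

lemma rect_diag_mult:
  assumes "\<And>i. i < min l n \<Longrightarrow> d i \<noteq> 0 \<Longrightarrow> i < m"
  shows "rect_diag l m d * rect_diag m n e = rect_diag l n (\<lambda>i. d i * e i)"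
proof (rule eq_matI)
  fix i j assume "i < dim_row (rect_diag l n (\<lambda>i. d i * e i))" "j < dim_col (rect_diag l n (\<lambda>i. d i * e i))"
  then have ij: "i < l" "j < n" by auto
  have "(rect_diag l m d * rect_diag m n e) $$ (i, j) =
      (\<Sum>k = 0..<m. rect_diag l m d $$ (i, k) * rect_diag m n e $$ (k, j))"
    using ij by (simp add: scalar_prod_def)
  also have "\<dots> = (\<Sum>k = 0..<m. if k = i then (if i = j then of_real (d i * e i) else 0) else 0)"
    using ij by (intro sum.cong refl) auto
  also have "\<dots> = rect_diag l n (\<lambda>i. d i * e i) $$ (i, j)"
    using ij assms[of i] by auto
  finally show "(rect_diag l m d * rect_diag m n e) $$ (i, j) = rect_diag l n (\<lambda>i. d i * e i) $$ (i, j)" .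
qed auto

lemma rect_diag_mult_vec:
  assumes x: "x \<in> carrier_vec n" and i: "i < m" and d: "d i \<noteq> 0 \<Longrightarrow> i < n"
  shows "(rect_diag m n d *\<^sub>v x) $ i = (if d i = 0 then 0 else of_real (d i) * x $ i)"
proof -
  have "(rect_diag m n d *\<^sub>v x) $ i = (\<Sum>k = 0..<n. rect_diag m n d $$ (i, k) * x $ k)"
    using x i by (simp add: scalar_prod_def)
  also have "\<dots> = (\<Sum>k = 0..<n. if k = i then of_real (d i) * x $ i else 0)"
    using x i by (intro sum.cong refl) auto
  finally show ?thesis using d by auto
qed

lemma frobenius_norm_rect_diag_diff:
  assumes s: "s \<le> min m n" and d: "\<And>i. s \<le> i \<Longrightarrow> d i = 0" "\<And>i. s \<le> i \<Longrightarrow> e i = 0"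
  shows "(frobenius_norm (rect_diag m n d - rect_diag m n e))\<^sup>2 = (\<Sum>i<s. (d i - e i)\<^sup>2)"
proof -
  have "(frobenius_norm (rect_diag m n d - rect_diag m n e))\<^sup>2
    = (\<Sum>i<m. \<Sum>j<n. (cmod ((rect_diag m n d - rect_diag m n e) $$ (i, j)))\<^sup>2)"
    by (simp add: frobenius_norm_def sum_nonneg)
  also have "\<dots> = (\<Sum>i<m. \<Sum>j<n. if j = i then (d i - e i)\<^sup>2 else 0)"
    by (intro sum.cong refl) (auto simp: norm_of_real simp flip: of_real_diff)
  also have "\<dots> = (\<Sum>i<m. if i < n then (d i - e i)\<^sup>2 else 0)"
    by (intro sum.cong refl) auto
  also have "\<dots> = (\<Sum>i<s. (d i - e i)\<^sup>2)"
    using s d by (intro sum.mono_neutral_cong_right) (auto simp: not_less)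
  finally show ?thesis .
qed

text \<open>The nonzero columns are nonzero multiples of distinct unit vectors. To see that these are
independent, replace the zero diagonal entries by \<open>1\<close>: the rows of the resulting invertible
square matrix include all of them.\<close>

lemma rank_rect_diag:
  assumes d: "\<And>i. d i \<noteq> 0 \<Longrightarrow> i < m \<and> i < n"
  shows "vec_space.rank m (rect_diag m n d) = card {i. d i \<noteq> 0}"
proof -
  interpret vec_space "TYPE(complex)" m .
  define b where "b i = complex_of_real (d i) \<cdot>\<^sub>v unit_vec m i" for i
  define U where "U = b ` {i. d i \<noteq> 0}"
  have col: "col (rect_diag m n d) i = b i" if "i < n" "i < m" for i
    using that by (intro eq_vecI) (auto simp: b_def unit_vec_def)
  have col0: "col (rect_diag m n d) i = 0\<^sub>v m" if "i < n" "d i = 0" for i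
    using that by (intro eq_vecI) auto
  have cols: "set (cols (rect_diag m n d)) = col (rect_diag m n d) ` {..<n}"
    by (auto simp: cols_def)
  have U_cols: "U \<subseteq> set (cols (rect_diag m n d))"
  proof
    fix y assume "y \<in> U"
    then obtain i where "d i \<noteq> 0" "y = b i" by (auto simp: U_def)
    then have "i < n" "y = col (rect_diag m n d) i" using d[of i] col[of i] by auto
    then show "y \<in> set (cols (rect_diag m n d))" by (auto simp: cols)
  qed
  have cols_U: "set (cols (rect_diag m n d)) \<subseteq> insert (0\<^sub>v m) U"
  proof
    fix y assume "y \<in> set (cols (rect_diag m n d))"
    then obtain i where "i < n" "y = col (rect_diag m n d) i" by (auto simp: cols)
    then show "y \<in> insert (0\<^sub>v m) U"
      using d[of i] col[of i] col0[of i] by (cases "d i = 0") (auto simp: U_def)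
  qed
  have inj: "inj_on b {i. d i \<noteq> 0}"
  proof (rule inj_onI)
    fix i j assume ij: "i \<in> {i. d i \<noteq> 0}" "j \<in> {i. d i \<noteq> 0}" "b i = b j"
    then have "b i $ i = b j $ i" "i < m" "j < m" using d by auto
    then show "i = j" using ij(1) by (cases "i = j") (auto simp: b_def)
  qed
  \<comment> \<open>Nonzero everywhere, and equal to \<open>d\<close> on the support of \<open>d\<close>.\<close>
  define e where "e i = (if d i = 0 then 1 else d i)" for i
  have e0: "e i \<noteq> 0" for i by (simp add: e_def)
  have rows: "row (rect_diag m m e) i = complex_of_real (e i) \<cdot>\<^sub>v unit_vec m i" if "i < m" for i
    using that by (intro eq_vecI) (auto simp: unit_vec_def)
  have "lin_indpt (set (rows (rect_diag m m e)))"
    using e0 by (intro upper_triangular_imp_lin_indpt_rows rect_diag_carrier) (auto simp: diag_mat_def)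
  moreover have "U \<subseteq> set (rows (rect_diag m m e))"
  proof
    fix y assume "y \<in> U"
    then obtain i where i: "d i \<noteq> 0" "y = b i" by (auto simp: U_def)
    then have "y = row (rect_diag m m e) i" using d[of i] rows[of i] by (simp add: b_def e_def)
    then show "y \<in> set (rows (rect_diag m m e))" using d[OF i(1)] by (simp add: rows_def)
  qed
  ultimately have indpt: "lin_indpt U" using supset_ld_is_ld by blast
  have "maximal U (\<lambda>T. T \<subseteq> set (cols (rect_diag m n d)) \<and> lin_indpt T)"
    unfolding maximal_def
  proof (intro conjI allI impI)
    fix T assume T: "U \<subseteq> T \<and> T \<subseteq> set (cols (rect_diag m n d)) \<and> lin_indpt T"
    then have "T \<subseteq> carrier_vec m" using cols_dim[of "rect_diag m n d"] by auto
    moreover have "(UNIV :: complex set) \<noteq> {0}" by (metis UNIV_I singletonD zero_neq_one)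
    ultimately have "0\<^sub>v m \<notin> T" using zero_nin_lin_indpt[of T] T by simp
    then show "T = U" using T cols_U by auto
  qed (use U_cols indpt in auto)
  then have "rank (rect_diag m n d) = card U" by (rule rank_card_indpt[OF rect_diag_carrier])
  also have "\<dots> = card {i. d i \<noteq> 0}" unfolding U_def by (rule card_image[OF inj])
  finally show ?thesis .
qed

lemma nonzero_singular_values_rect_diag:
  assumes d: "\<And>i. d i \<noteq> 0 \<Longrightarrow> i < m \<and> i < n"
  shows "nonzero_singular_values (rect_diag m n d) = image_mset (\<lambda>i. \<bar>d i\<bar>) (mset_set {i. d i \<noteq> 0})"
proof -
  have "mat_adjoint (rect_diag m n d) * rect_diag m n d = rect_diag n n (\<lambda>i. d i * d i)"
    using d by (simp add: rect_diag_mult)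
  moreover have "char_poly (rect_diag n n (\<lambda>i. d i * d i)) = (\<Prod>e \<leftarrow> map (\<lambda>i. of_real ((d i)\<^sup>2)) [0..<n]. [:- e, 1:])"
    by (subst char_poly_upper_triangular[of _ n]) 
      (auto simp: diag_mat_def power2_eq_square intro!: arg_cong[of _ _ prod_list])
  moreover have "proots (\<Prod>e \<leftarrow> es. [:- e, 1:]) = mset es" for es :: "complex list"
  proof (induction es)
    case (Cons e es)
    have "(\<Prod>e \<leftarrow> es. [:- e, 1:]) \<noteq> 0" by (auto simp: prod_list_zero_iff)
    then show ?case using Cons by (simp add: proots_mult del: mult_pCons_left)
  qed auto
  ultimately have "proots (char_poly (mat_adjoint (rect_diag m n d) * rect_diag m n d))
      = mset (map (\<lambda>i. of_real ((d i)\<^sup>2)) [0..<n])"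
    by (simp only:)
  then have "singular_values (rect_diag m n d) = mset (map (\<lambda>i. \<bar>d i\<bar>) [0..<n])"
    by (simp add: singular_values_def multiset.map_comp comp_def del: mat_adjoint_rect_diag)
  then have "nonzero_singular_values (rect_diag m n d) = image_mset (\<lambda>i. \<bar>d i\<bar>) (filter_mset (\<lambda>i. d i \<noteq> 0) (mset_set {0..<n}))"
    by (simp add: nonzero_singular_values_def filter_mset_image_mset comp_def)
  also have "filter_mset (\<lambda>i. d i \<noteq> 0) (mset_set {0..<n}) = mset_set {i. d i \<noteq> 0}"
    using d by (subst filter_mset_mset_set) (auto intro!: arg_cong[of _ _ mset_set])
  finally show ?thesis .
qed

text \<open>The vectors that vanish where \<open>d\<close> does form the range of the absolute values, the range of the
adjoint of the sign matrix, and the orthogonal complement of the kernel of the sign matrix.\<close>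

lemma generalized_polar_rect_diag:
  assumes d: "\<And>i. d i \<noteq> 0 \<Longrightarrow> i < m \<and> i < n"
  shows "generalized_polar (rect_diag m n d) (rect_diag m n (\<lambda>i. sgn (d i))) (rect_diag n n (\<lambda>i. \<bar>d i\<bar>))"
proof -
  let ?Q = "rect_diag m n (\<lambda>i. sgn (d i))" and ?H = "rect_diag n n (\<lambda>i. \<bar>d i\<bar>)"
  have Q_vec: "(?Q *\<^sub>v x) $ i = (if d i = 0 then 0 else of_real (sgn (d i)) * x $ i)"
    if "x \<in> carrier_vec n" "i < m" for x i
    using that d[of i] by (subst rect_diag_mult_vec) (auto simp: sgn_eq_0_iff)
  have vanish: "x $ i = 0" if x: "x \<in> carrier_vec n" "\<forall>y \<in> mat_kernel ?Q. x \<bullet>c y = 0" and i: "i < n" "d i = 0" for x i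
  proof -
    have "?Q *\<^sub>v unit_vec n i = 0\<^sub>v m"
      using i d by (intro eq_vecI) (auto simp: Q_vec simp del: index_mult_mat_vec)
    then have "unit_vec n i \<in> mat_kernel ?Q" by (intro mat_kernelI[of _ m n]) auto
    then have "x \<bullet>c unit_vec n i = 0" using x by blast
    moreover have "conjugate (unit_vec n i :: complex vec) = unit_vec n i"
      by (intro eq_vecI) (auto simp: unit_vec_def)
    ultimately show ?thesis using x i by (simp add: scalar_prod_right_unit[of _ n])
  qed
  have "subunitary ?Q"
    unfolding subunitary_def
  proof (intro ballI impI)
    fix x assume "x \<in> carrier_vec (dim_col ?Q)" and ker: "\<forall>y \<in> mat_kernel ?Q. x \<bullet>c y = 0"
    then have x: "x \<in> carrier_vec n" by simp
    have "(\<Sum>i<m. (cmod ((?Q *\<^sub>v x) $ i))\<^sup>2) = (\<Sum>i | d i \<noteq> 0. (cmod (x $ i))\<^sup>2)"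
      using d x by (intro sum.mono_neutral_cong_right)
        (auto simp: Q_vec norm_mult abs_sgn_eq simp del: index_mult_mat_vec)
    also have "\<dots> = (\<Sum>i<n. (cmod (x $ i))\<^sup>2)"
      using d vanish[OF x ker] by (intro sum.mono_neutral_cong_left) auto
    finally show "(?Q *\<^sub>v x) \<bullet>c (?Q *\<^sub>v x) = x \<bullet>c x"
      using x by (simp add: cscalar_self del: of_real_sum of_real_power)
  qed
  moreover have "pos_semidef ?H"
    unfolding pos_semidef_def
  proof (intro conjI ballI)
    fix x :: "complex vec" assume "x \<in> carrier_vec (dim_row ?H)"
    then have x: "x \<in> carrier_vec n" by simp
    have "(?H *\<^sub>v x) \<bullet>c x = (\<Sum>i = 0..<n. of_real (\<bar>d i\<bar> * (cmod (x $ i))\<^sup>2))"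
      using x by (auto simp: scalar_prod_def[of "?H *\<^sub>v x"] rect_diag_mult_vec complex_norm_square mult.assoc
          simp del: of_real_power index_mult_mat_vec intro!: sum.cong)
    also have "\<dots> = of_real (\<Sum>i = 0..<n. \<bar>d i\<bar> * (cmod (x $ i))\<^sup>2)" by simp
    finally show "0 \<le> (?H *\<^sub>v x) \<bullet>c x" by (simp add: less_eq_complex_def sum_nonneg)
  qed auto
  moreover have "rect_diag m n d = ?Q * ?H"
    by (subst rect_diag_mult) (auto simp: sgn_eq_0_iff sgn_mult_abs)
  moreover have "vec_space.col_space n (rect_diag n k e) = {y \<in> carrier_vec n. \<forall>i<n. d i = 0 \<longrightarrow> y $ i = 0}"
    if e: "\<And>i. e i = 0 \<longleftrightarrow> d i = 0" and k: "\<And>i. d i \<noteq> 0 \<Longrightarrow> i < k" for e k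
  proof -
    have "\<exists>x \<in> carrier_vec k. rect_diag n k e *\<^sub>v x = y"
      if y: "y \<in> carrier_vec n" "\<forall>i<n. d i = 0 \<longrightarrow> y $ i = 0" for y
    proof (intro bexI eq_vecI)
      fix i assume "i < dim_vec y"
      then have i: "i < n" using y by simp
      show "(rect_diag n k e *\<^sub>v vec k (\<lambda>i. y $ i / of_real (e i))) $ i = y $ i"
        using i y e k by (subst rect_diag_mult_vec) auto
    qed (use y in auto)
    moreover have "(rect_diag n k e *\<^sub>v x) $ i = 0" if "x \<in> carrier_vec k" "i < n" "d i = 0" for x i
      using that e[of i] by (subst rect_diag_mult_vec) auto
    ultimately show ?thesis
      unfolding vec_space.col_space_eq[OF rect_diag_carrier] by (auto simp del: index_mult_mat_vec)
  qed
  then have "vec_space.col_space n (mat_adjoint ?Q) = vec_space.col_space n ?H"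
    using d by (simp add: sgn_eq_0_iff)
  moreover have "vec_space.rank m (rect_diag m n d) = card {i. d i \<noteq> 0}"
    "vec_space.rank m ?Q = card {i. d i \<noteq> 0}" "vec_space.rank n ?H = card {i. d i \<noteq> 0}"
    using rank_rect_diag[of d m n] rank_rect_diag[of "\<lambda>i. sgn (d i)" m n] rank_rect_diag[of "\<lambda>i. \<bar>d i\<bar>" n n] d
    by (simp_all add: sgn_eq_0_iff)
  ultimately show ?thesis by (simp add: generalized_polar_def Let_def cmats_of_rank_def)
qed

section \<open>The sharp perturbation bound\<close>

text \<open>If \<open>k = 0\<close>, a nonzero numerator means \<open>r < s\<close>, and then the last sum in the denominator is
positive; if \<open>k \<ge> 1\<close>, the first sum is. So a zero denominator only occurs in the form \<open>0 / 0\<close>.\<close>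

lemma polar_den_pos:
  assumes "r \<le> s" "\<forall>i \<in> {1..r}. 0 < \<sigma> i" "\<forall>i \<in> {1..s}. 0 < \<sigma>' i"
    and k: "k \<le> r" and num: "polar_num r s k \<noteq> 0"
  shows "0 < polar_den r s \<sigma> \<sigma>' k"
proof (cases "k = 0")
  case True
  then have "r < s" using num assms(1) by (simp add: polar_num_def)
  then have "(\<sigma>' 1)\<^sup>2 \<le> (\<Sum>j = k + 1..s - r + k. (\<sigma>' j)\<^sup>2)"
    using True by (intro member_le_sum) auto
  moreover have "0 < \<sigma>' 1" using assms(3) \<open>r < s\<close> by simp
  then have "0 < (\<sigma>' 1)\<^sup>2" by simp
  ultimately have "0 < (\<Sum>j = k + 1..s - r + k. (\<sigma>' j)\<^sup>2)" by linarith
  then show ?thesis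
    unfolding polar_den_def by (intro add_nonneg_pos add_nonneg_nonneg sum_nonneg) auto
next
  case False
  then have "(\<sigma> 1 + \<sigma>' 1)\<^sup>2 \<le> (\<Sum>j = 1..k. (\<sigma> j + \<sigma>' j)\<^sup>2)"
    by (intro member_le_sum) auto
  moreover have "0 < \<sigma> 1" "0 < \<sigma>' 1" using assms False by auto
  then have "0 < (\<sigma> 1 + \<sigma>' 1)\<^sup>2" by simp
  ultimately have "0 < (\<Sum>j = 1..k. (\<sigma> j + \<sigma>' j)\<^sup>2)" by linarith
  then show ?thesis
    unfolding polar_den_def by (intro add_pos_nonneg sum_nonneg) auto
qed

text \<open>The minimum is the largest \<open>\<rho>\<close> with \<open>\<rho> * polar_den \<le> polar_num\<close> for all indices, and equality
holds at a minimizer with a positive denominator. In this form the inequality also covers the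
omitted index, where it reads \<open>0 \<le> 0\<close>.\<close>

lemma polar_coeff_attained:
  assumes r: "1 \<le> r" "r \<le> s" and \<sigma>: "\<forall>i \<in> {1..r}. 0 < \<sigma> i" and \<sigma>': "\<forall>i \<in> {1..s}. 0 < \<sigma>' i"
  obtains \<rho> k where "polar_coeff r s \<sigma> \<sigma>' = sqrt \<rho>" "0 \<le> \<rho>"
    "\<And>j. j \<le> r \<Longrightarrow> \<rho> * polar_den r s \<sigma> \<sigma>' j \<le> polar_num r s j"
    "k \<le> r" "0 < polar_den r s \<sigma> \<sigma>' k" "\<rho> * polar_den r s \<sigma> \<sigma>' k = polar_num r s k"
proof -
  let ?num = "polar_num r s" and ?den = "polar_den r s \<sigma> \<sigma>'"
  define K where "K = {k \<in> {0..r}. \<not> (?num k = 0 \<and> ?den k = 0)}"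
  define \<rho> where "\<rho> = Min ((\<lambda>k. ?num k / ?den k) ` K)"
  have num0: "0 \<le> ?num k" for k using r by (simp add: polar_num_def)
  have den0: "0 \<le> ?den k" for k
    unfolding polar_den_def by (intro add_nonneg_nonneg sum_nonneg) auto
  have pos: "0 < ?den k" if "k \<in> K" for k
    using that den0[of k] polar_den_pos[OF r(2) \<sigma> \<sigma>', of k] by (cases "?num k = 0") (auto simp: K_def)
  have "?num r \<noteq> 0" using r by (simp add: polar_num_def)
  then have K: "finite K" "K \<noteq> {}" by (auto simp: K_def)
  then have "\<rho> \<in> (\<lambda>k. ?num k / ?den k) ` K" unfolding \<rho>_def by (intro Min_in) auto
  then obtain k where k: "k \<in> K" "\<rho> = ?num k / ?den k" by blast
  show thesis
  proof (rule that[of \<rho> k])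
    show "polar_coeff r s \<sigma> \<sigma>' = sqrt \<rho>" by (simp add: polar_coeff_def \<rho>_def K_def)
    show "0 \<le> \<rho>" using k(2) num0 den0 by simp
    show "\<rho> * ?den j \<le> ?num j" if "j \<le> r" for j
    proof (cases "j \<in> K")
      case True
      then have "\<rho> \<le> ?num j / ?den j" unfolding \<rho>_def using K by (intro Min_le) auto
      then show ?thesis using pos[OF True] by (simp add: pos_le_divide_eq)
    next
      case False
      then show ?thesis using that by (auto simp: K_def)
    qed
    show "k \<le> r" "0 < ?den k" using k(1) pos by (auto simp: K_def)
    then show "\<rho> * ?den k = ?num k" by (simp add: k(2))
  qed
qed

text \<open>By the inequality between arithmetic and geometric mean, the product of the overlaps of left and
of right singular vectors is at most the mean of their squares, which is doubly substochastic.\<close>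

lemma polar_perturbation_bound:
  assumes rs: "r \<le> s"
    and \<sigma>: "antimono_on {1..r} \<sigma>" "\<forall>i \<in> {1..r}. 0 < \<sigma> i"
    and \<sigma>': "antimono_on {1..s} \<sigma>'" "\<forall>i \<in> {1..s}. 0 < \<sigma>' i"
    and \<rho>: "0 \<le> \<rho>" "\<And>k. k \<le> r \<Longrightarrow> \<rho> * polar_den r s \<sigma> \<sigma>' k \<le> polar_num r s k"
    and A: "A \<in> carrier_mat m n" "generalized_polar A Q H"
      "nonzero_singular_values A = image_mset \<sigma> (mset_set {1..r})"
    and B: "B \<in> carrier_mat m n" "generalized_polar B Q' H'"
      "nonzero_singular_values B = image_mset \<sigma>' (mset_set {1..s})"
  shows "\<rho> * (frobenius_norm (A - B))\<^sup>2 \<le> (frobenius_norm (Q - Q'))\<^sup>2"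
proof -
  obtain u v where uv: "orthonormal m r u" "orthonormal n r v"
    "A = singular_expansion m n r \<sigma> u v" "Q = singular_expansion m n r (\<lambda>_. 1) u v"
    using generalized_polar_singular_expansion[OF A \<sigma>(2)] by blast
  obtain u' v' where uv': "orthonormal m s u'" "orthonormal n s v'"
    "B = singular_expansion m n s \<sigma>' u' v'" "Q' = singular_expansion m n s (\<lambda>_. 1) u' v'"
    using generalized_polar_singular_expansion[OF B \<sigma>'(2)] by blast
  define a where "a i j = (\<Sum>p<m. u i p * cnj (u' j p))" for i j
  define b where "b i j = (\<Sum>q<n. v i q * cnj (v' j q))" for i j
  define M where "M i j = Re (a i j * cnj (b i j))" for i j
  define T where "T i j = ((cmod (a i j))\<^sup>2 + (cmod (b i j))\<^sup>2) / 2" for i j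
  note a = orthonormal_overlaps_substochastic[OF uv(1) uv'(1), folded a_def]
  note b = orthonormal_overlaps_substochastic[OF uv(2) uv'(2), folded b_def]
  have MT: "\<bar>M i j\<bar> \<le> T i j" for i j
  proof -
    have "\<bar>M i j\<bar> \<le> cmod (a i j) * cmod (b i j)"
      unfolding M_def by (rule order_trans[OF abs_Re_le_cmod]) (simp add: norm_mult)
    also have "\<dots> \<le> T i j"
      using sum_squares_bound[of "cmod (a i j)" "cmod (b i j)"] by (simp add: T_def)
    finally show ?thesis .
  qed
  have rows: "(\<Sum>j = 1..s. T i j) \<le> 1" if "i \<in> {1..r}" for i
    using a(1)[OF that] b(1)[OF that] unfolding T_def sum_divide_distrib[symmetric] sum.distrib by simp
  have cols: "(\<Sum>i = 1..r. T i j) \<le> 1" if "j \<in> {1..s}" for j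
    using a(2)[OF that] b(2)[OF that] unfolding T_def sum_divide_distrib[symmetric] sum.distrib by simp
  note diff = frobenius_norm_singular_expansion_diff[OF uv(1,2) uv'(1,2), folded a_def b_def, folded M_def]
  show ?thesis
    using polar_inequality_substochastic[OF rs \<sigma> \<sigma>' MT rows cols \<rho>]
    unfolding uv(3,4) uv'(3,4) diff by simp
qed

text \<open>Two diagonal matrices realize the pairing that is extremal for \<open>k\<close>. The first \<open>k\<close> positions
pair \<open>\<sigma>\<close> with \<open>\<sigma>'\<close> in the same order and with opposite signs, the last \<open>r - k\<close> positions pair
the remaining values of \<open>\<sigma>\<close> with the smallest of \<open>\<sigma>'\<close> in reverse order and with equal signs,
and the \<open>s - r\<close> positions in between pair \<open>0\<close> with \<open>\<sigma>'\<close>. The signs are carried by the second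
matrix.\<close>

lemma polar_bound_attained:
  assumes r: "r \<le> s" and s: "s \<le> min m n"
    and \<sigma>: "\<forall>i \<in> {1..r}. 0 < \<sigma> i" and \<sigma>': "\<forall>i \<in> {1..s}. 0 < \<sigma>' i" and k: "k \<le> r"
  obtains A B Q H Q' H' where
    "A \<in> cmats_of_rank m n r" "B \<in> cmats_of_rank m n s" "generalized_polar A Q H" "generalized_polar B Q' H'"
    "nonzero_singular_values A = image_mset \<sigma> (mset_set {1..r})"
    "nonzero_singular_values B = image_mset \<sigma>' (mset_set {1..s})"
    "(frobenius_norm (A - B))\<^sup>2 = polar_den r s \<sigma> \<sigma>' k" "(frobenius_norm (Q - Q'))\<^sup>2 = polar_num r s k"
proof -
  define d where "d i = (if i < k then \<sigma> (Suc i) else if s - r + k \<le> i \<and> i < s then \<sigma> (s + k - i) else 0)" for i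
  define e where "e i = (if i < k then - \<sigma>' (Suc i) else if i < s then \<sigma>' (Suc i) else 0)" for i
  have d_pos: "0 < d i" if "i < k \<or> s - r + k \<le> i \<and> i < s" for i
  proof -
    have "0 < \<sigma> (Suc i)" if "i < k" using that \<sigma> k by simp
    moreover have "0 < \<sigma> (s + k - i)" if "s - r + k \<le> i" "i < s"
      using that k r by (intro bspec[OF \<sigma>]) auto
    ultimately show ?thesis using that by (auto simp: d_def)
  qed
  have d0: "d i \<noteq> 0 \<longleftrightarrow> i < k \<or> s - r + k \<le> i \<and> i < s" for i
    using d_pos[of i] by (auto simp: d_def)
  have e0: "e i \<noteq> 0 \<longleftrightarrow> i < s" and sgn_e: "i < s \<Longrightarrow> sgn (e i) = (if i < k then -1 else 1)" for i
  proof -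
    have "i < s \<Longrightarrow> 0 < \<sigma>' (Suc i)" using \<sigma>' by auto
    then show "e i \<noteq> 0 \<longleftrightarrow> i < s" "i < s \<Longrightarrow> sgn (e i) = (if i < k then -1 else 1)"
      using k r by (auto simp: e_def)
  qed
  have sgn_d: "sgn (d i) = of_bool (i < k \<or> s - r + k \<le> i \<and> i < s)" for i
    using d_pos[of i] d0[of i] by auto
  have d_supp: "d i \<noteq> 0 \<Longrightarrow> i < m \<and> i < n" and e_supp: "e i \<noteq> 0 \<Longrightarrow> i < m \<and> i < n" for i
    using d0[of i] e0[of i] k r s by auto
  define I where "I = {i. d i \<noteq> 0}"
  \<comment> \<open>The index of the value of \<open>\<sigma>\<close> that occurs at position \<open>i\<close>.\<close>
  define \<pi> where "\<pi> i = (if i < k then Suc i else s + k - i)" for i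
  have I: "I = {..<k} \<union> {s - r + k..<s}" unfolding I_def d0 using k r by auto
  have \<pi>: "bij_betw \<pi> I {1..r}"
    unfolding I using k r
    by (intro bij_betw_byWitness[where f' = "\<lambda>j. if j \<le> k then j - 1 else s + k - j"]) (auto simp: \<pi>_def)
  have ds: "image_mset (\<lambda>i. \<bar>d i\<bar>) (mset_set I) = image_mset \<sigma> (mset_set {1..r})"
  proof -
    have "image_mset (\<lambda>i. \<bar>d i\<bar>) (mset_set I) = image_mset (\<lambda>i. \<sigma> (\<pi> i)) (mset_set I)"
    proof (intro image_mset_cong)
      fix i assume "i \<in># mset_set I"
      then have i: "i < k \<or> s - r + k \<le> i \<and> i < s" by (auto simp: I)
      then show "\<bar>d i\<bar> = \<sigma> (\<pi> i)" using d_pos[OF i] by (auto simp: d_def \<pi>_def)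
    qed
    also have "\<dots> = image_mset \<sigma> (image_mset \<pi> (mset_set I))" by (simp add: multiset.map_comp comp_def)
    also have "image_mset \<pi> (mset_set I) = mset_set {1..r}"
      using \<pi> by (simp add: image_mset_mset_set bij_betw_def)
    finally show ?thesis .
  qed
  have es: "image_mset (\<lambda>i. \<bar>e i\<bar>) (mset_set {i. e i \<noteq> 0}) = image_mset \<sigma>' (mset_set {1..s})"
  proof -
    have "image_mset (\<lambda>i. \<bar>e i\<bar>) (mset_set {..<s}) = image_mset (\<lambda>i. \<sigma>' (Suc i)) (mset_set {..<s})"
    proof (intro image_mset_cong)
      fix i assume "i \<in># mset_set {..<s}"
      then have "i < s" "0 < \<sigma>' (Suc i)" using \<sigma>' by auto
      then show "\<bar>e i\<bar> = \<sigma>' (Suc i)" by (simp add: e_def)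
    qed
    also have "\<dots> = image_mset \<sigma>' (image_mset Suc (mset_set {..<s}))" by (simp add: multiset.map_comp comp_def)
    also have "image_mset Suc (mset_set {..<s}) = mset_set {1..s}"
      by (subst image_mset_mset_set) (auto simp: image_Suc_lessThan)
    finally show ?thesis by (simp add: e0 lessThan_def)
  qed
  have s_parts: "(\<Sum>i<s. f i) = (\<Sum>i<k. f i) + (\<Sum>i = k..<s - r + k. f i) + (\<Sum>i = s - r + k..<s. f i)"
    for f :: "nat \<Rightarrow> real"
    using sum.atLeastLessThan_concat[of 0 k "s - r + k" f]
      sum.atLeastLessThan_concat[of 0 "s - r + k" s f] k r
    by (simp add: lessThan_atLeast0)
  have d_zero: "d i = 0" and e_zero: "e i = 0" if "s \<le> i" for i
    using that k r by (simp_all add: d_def e_def)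
  have "(frobenius_norm (rect_diag m n d - rect_diag m n e))\<^sup>2 = (\<Sum>i<s. (d i - e i)\<^sup>2)"
    by (rule frobenius_norm_rect_diag_diff[OF s d_zero e_zero])
  also have "\<dots> = polar_den r s \<sigma> \<sigma>' k"
  proof -
    have "(\<Sum>i<k. (d i - e i)\<^sup>2) = (\<Sum>j = 1..k. (\<sigma> j + \<sigma>' j)\<^sup>2)"
      unfolding One_nat_def sum.atLeast1_atMost_eq by (intro sum.cong) (auto simp: d_def e_def)
    moreover have "(\<Sum>i = k..<s - r + k. (d i - e i)\<^sup>2) = (\<Sum>j = Suc k..s - r + k. (\<sigma>' j)\<^sup>2)"
      using k r by (intro sum.reindex_bij_witness[of _ "\<lambda>j. j - 1" Suc]) (auto simp: d_def e_def)
    moreover have "(\<Sum>i = s - r + k..<s. (d i - e i)\<^sup>2) = (\<Sum>i = Suc k..r. (\<sigma> i - \<sigma>' (s + 1 + k - i))\<^sup>2)"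
      using k r by (intro sum.reindex_bij_witness[of _ "\<lambda>j. s + k - j" "\<lambda>i. s + k - i"])
        (auto simp: d_def e_def Suc_diff_le)
    ultimately show ?thesis unfolding s_parts polar_den_reindexed[OF k r] by simp
  qed
  finally have den: "(frobenius_norm (rect_diag m n d - rect_diag m n e))\<^sup>2 = polar_den r s \<sigma> \<sigma>' k" .
  have "(frobenius_norm (rect_diag m n (\<lambda>i. sgn (d i)) - rect_diag m n (\<lambda>i. sgn (e i))))\<^sup>2
      = (\<Sum>i<s. (sgn (d i) - sgn (e i))\<^sup>2)"
    by (rule frobenius_norm_rect_diag_diff[OF s]) (simp_all add: d_zero e_zero)
  also have "\<dots> = (\<Sum>i<k. 4) + (\<Sum>i = k..<s - r + k. 1) + (\<Sum>i = s - r + k..<s. 0)"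
    unfolding s_parts using k r by (intro arg_cong2[of _ _ _ _ plus] sum.cong) (auto simp: sgn_d sgn_e)
  also have "\<dots> = polar_num r s k" using r by (simp add: polar_num_def of_nat_diff)
  finally have num: "(frobenius_norm (rect_diag m n (\<lambda>i. sgn (d i)) - rect_diag m n (\<lambda>i. sgn (e i))))\<^sup>2
      = polar_num r s k" .
  have "card {i. d i \<noteq> 0} = r" using bij_betw_same_card[OF \<pi>] by (simp add: I_def)
  moreover have "card {i. e i \<noteq> 0} = s" by (simp add: e0)
  ultimately show thesis
    using that[of "rect_diag m n d" "rect_diag m n e" "rect_diag m n (\<lambda>i. sgn (d i))" "rect_diag n n (\<lambda>i. \<bar>d i\<bar>)"
        "rect_diag m n (\<lambda>i. sgn (e i))" "rect_diag n n (\<lambda>i. \<bar>e i\<bar>)"]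
      generalized_polar_rect_diag[OF d_supp] generalized_polar_rect_diag[OF e_supp]
      nonzero_singular_values_rect_diag[OF d_supp] nonzero_singular_values_rect_diag[OF e_supp]
      rank_rect_diag[OF d_supp] rank_rect_diag[OF e_supp] ds es den num
    by (simp add: cmats_of_rank_def I_def)
qed

lemma frobenius_norm_nonneg: "0 \<le> frobenius_norm A"
  by (simp add: frobenius_norm_def sum_nonneg)

lemma frobenius_norm_minus_commute:
  "A \<in> carrier_mat m n \<Longrightarrow> B \<in> carrier_mat m n \<Longrightarrow> frobenius_norm (A - B) = frobenius_norm (B - A)"
  by (auto simp: frobenius_norm_def norm_minus_commute intro!: sum.cong)

theorem theorem1p9:
  fixes m n r s :: nat and \<sigma> \<sigma>' :: "nat \<Rightarrow> real"
  assumes "1 \<le> r" and "r \<le> s"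
    and "antimono_on {1..r} \<sigma>" and "\<forall>i \<in> {1..r}. 0 < \<sigma> i"
    and "antimono_on {1..s} \<sigma>'" and "\<forall>i \<in> {1..s}. 0 < \<sigma>' i"
  shows
    "(\<forall>A E Q H Q' H'.
        A \<in> cmats_of_rank m n r \<and> E \<in> carrier_mat m n \<and> A + E \<in> cmats_of_rank m n s \<and>
        generalized_polar A Q H \<and> generalized_polar (A + E) Q' H' \<and>
        nonzero_singular_values A = image_mset \<sigma> (mset_set {1..r}) \<and>
        nonzero_singular_values (A + E) = image_mset \<sigma>' (mset_set {1..s}) \<longrightarrow>
        frobenius_norm (Q - Q') \<ge> polar_coeff r s \<sigma> \<sigma>' * frobenius_norm E) \<and>
     (s \<le> min m n \<longrightarrow>
      (\<forall>c > polar_coeff r s \<sigma> \<sigma>'.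
        \<not> (\<forall>A E Q H Q' H'.
            A \<in> cmats_of_rank m n r \<and> E \<in> carrier_mat m n \<and> A + E \<in> cmats_of_rank m n s \<and>
            generalized_polar A Q H \<and> generalized_polar (A + E) Q' H' \<and>
            nonzero_singular_values A = image_mset \<sigma> (mset_set {1..r}) \<and>
            nonzero_singular_values (A + E) = image_mset \<sigma>' (mset_set {1..s}) \<longrightarrow>
            frobenius_norm (Q - Q') \<ge> c * frobenius_norm E)))"
proof -
  obtain \<rho> k where \<rho>: "polar_coeff r s \<sigma> \<sigma>' = sqrt \<rho>" "0 \<le> \<rho>"
    "\<And>j. j \<le> r \<Longrightarrow> \<rho> * polar_den r s \<sigma> \<sigma>' j \<le> polar_num r s j"
    and k: "k \<le> r" "0 < polar_den r s \<sigma> \<sigma>' k" "\<rho> * polar_den r s \<sigma> \<sigma>' k = polar_num r s k"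
    using polar_coeff_attained[OF assms(1,2,4,6)] by metis
  show ?thesis
  proof (intro conjI allI impI)
    fix A E Q H Q' H'
    assume hyps: "A \<in> cmats_of_rank m n r \<and> E \<in> carrier_mat m n \<and> A + E \<in> cmats_of_rank m n s \<and>
        generalized_polar A Q H \<and> generalized_polar (A + E) Q' H' \<and>
        nonzero_singular_values A = image_mset \<sigma> (mset_set {1..r}) \<and>
        nonzero_singular_values (A + E) = image_mset \<sigma>' (mset_set {1..s})"
    then have A: "A \<in> carrier_mat m n" and E: "E \<in> carrier_mat m n" by (auto simp: cmats_of_rank_def)
    have AE: "A + E \<in> carrier_mat m n" using A E by simp
    have "(A + E) - A = E" using A E by (intro eq_matI) auto
    then have "frobenius_norm (A - (A + E)) = frobenius_norm E"
      using frobenius_norm_minus_commute[OF A AE] by simp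
    moreover have "\<rho> * (frobenius_norm (A - (A + E)))\<^sup>2 \<le> (frobenius_norm (Q - Q'))\<^sup>2"
      using hyps A AE by (intro polar_perturbation_bound[OF assms(2-6) \<rho>(2,3)]) auto
    ultimately have "sqrt (\<rho> * (frobenius_norm E)\<^sup>2) \<le> sqrt ((frobenius_norm (Q - Q'))\<^sup>2)"
      by (intro real_sqrt_le_mono) simp
    then show "polar_coeff r s \<sigma> \<sigma>' * frobenius_norm E \<le> frobenius_norm (Q - Q')"
      by (simp add: \<rho>(1) real_sqrt_mult frobenius_norm_nonneg)
  next
    fix c assume s: "s \<le> min m n" and c: "polar_coeff r s \<sigma> \<sigma>' < c"
    obtain A B Q H Q' H' where ex: "A \<in> cmats_of_rank m n r" "B \<in> cmats_of_rank m n s"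
      "generalized_polar A Q H" "generalized_polar B Q' H'"
      "nonzero_singular_values A = image_mset \<sigma> (mset_set {1..r})"
      "nonzero_singular_values B = image_mset \<sigma>' (mset_set {1..s})"
      and den: "(frobenius_norm (A - B))\<^sup>2 = polar_den r s \<sigma> \<sigma>' k"
      and num: "(frobenius_norm (Q - Q'))\<^sup>2 = polar_num r s k"
      using polar_bound_attained[OF assms(2) s assms(4,6) k(1)] by blast
    have carrier: "A \<in> carrier_mat m n" "B \<in> carrier_mat m n"
      using ex(1,2) by (auto simp: cmats_of_rank_def)
    then have AB: "A + (B - A) = B" "B - A \<in> carrier_mat m n" by (auto intro!: eq_matI)
    have "(frobenius_norm (Q - Q'))\<^sup>2 = \<rho> * (frobenius_norm (A - B))\<^sup>2"
      using k(3) den num by simp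
    then have "frobenius_norm (Q - Q') = sqrt \<rho> * frobenius_norm (A - B)"
      by (metis abs_of_nonneg frobenius_norm_nonneg real_sqrt_abs real_sqrt_mult)
    moreover have "0 < frobenius_norm (A - B)"
      using k(2) den frobenius_norm_nonneg[of "A - B"] by (auto simp: less_le)
    ultimately have "frobenius_norm (Q - Q') < c * frobenius_norm (B - A)"
      using c frobenius_norm_minus_commute[OF carrier] by (simp add: \<rho>(1))
    then show "\<not> (\<forall>A E Q H Q' H'.
            A \<in> cmats_of_rank m n r \<and> E \<in> carrier_mat m n \<and> A + E \<in> cmats_of_rank m n s \<and>
            generalized_polar A Q H \<and> generalized_polar (A + E) Q' H' \<and>
            nonzero_singular_values A = image_mset \<sigma> (mset_set {1..r}) \<and>
            nonzero_singular_values (A + E) = image_mset \<sigma>' (mset_set {1..s}) \<longrightarrow>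
            frobenius_norm (Q - Q') \<ge> c * frobenius_norm E)"
      using ex AB
      by (intro notI) (drule spec[of _ A], drule spec[of _ "B - A"], drule spec[of _ Q], drule spec[of _ H],
          drule spec[of _ Q'], drule spec[of _ H'], simp)
  qed
qed

end
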